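(* Let $K=\{(\cos\varphi,\sin\varphi):\varphi\in(0,\pi)\}$ be the upper half circle in the unit circle $S_2\subset\mathbb R^2$, $\gamma_1=\{(-1,0)\}$, $\gamma_2=\{(1,0)\}$, with angular coordinate $\varphi\in(0,\pi)$. Denote by $E_n^{1,q},H_n^{1,q},\omega_n^{1,q}$ the eigenforms and eigenvalues of the Maxwell system on $(K,\gamma_1,\gamma_2)$ for $q$-forms with $\varepsilon=\mu=\operatorname{id}$. (i) For $q=0$, up to normalizing constants, $$E_n^{1,0}=\cos\big((n-\tfrac12)\varphi\big),\qquad H_n^{1,0}=-i\sin\big((n-\tfrac12)\varphi\big)\,d\varphi,\qquad\omega_n^{1,0}=n-\tfrac12\qquad(n\in\mathbb N).$$ (ii) For $q=1$ the orthonormal systems $\{E_n^{1,1}\}$, $\{H_n^{1,1}\}$ are empty.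
   Context: $\mathbb N=\{1,2,\dots\}$. On a Riemannian manifold $M$ of dimension $d$ (here $M=S_2$, $d=1$), $\operatorname{rot}=d$ is the exterior derivative and $\operatorname{div}=(-1)^{d(q-1)}*d*$ on $q$-forms; $L_2^q(S)$ has inner product $\langle E,H\rangle_{q,S}=\int_SE\wedge*\overline H$. On $K$: $\operatorname{rot}e(\varphi)=e'(\varphi)\,d\varphi$, $\operatorname{div}(h(\varphi)\,d\varphi)=h'(\varphi)$; forms of degree $<0$ or $>1$ vanish. For $(S,\Gamma_1,\Gamma_2)$ with $S\subset M$ open, relatively compact, $\partial S=\Gamma_1\cup\Gamma_2\cup\gamma$ disjointly ($\Gamma_i$ relatively open in $\partial S$ with common boundary $\gamma$; here $\gamma=\emptyset$), $C_\infty^{q,\Gamma}(\overline S)$ denotes restrictions to $S$ of smooth $q$-forms on $M$ whose support has positive distance to $\Gamma$. $R^{q,\Gamma_1}(S)$ is the set of $E\in L_2^q(S)$ having $\operatorname{rot}E\in L_2^{q+1}(S)$ with $\langle E,\operatorname{div}\Phi\rangle_{q,S}=-\langle\operatorname{rot}E,\Phi\rangle_{q+1,S}$ for all $\Phi\in C_\infty^{q+1,\Gamma_2}(\overline S)$; $D^{q,\Gamma_2}(S)$ is the set of $E\in L_2^q(S)$ having $\operatorname{div}E\in L_2^{q-1}(S)$ with $\langle E,\operatorname{rot}\Phi\rangle_{q,S}=-\langle\operatorname{div}E,\Phi\rangle_{q-1,S}$ for all $\Phi\in C_\infty^{q-1,\Gamma_1}(\overline S)$. A lower index $0$ means $\operatorname{rot}E=0$,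 resp. $\operatorname{div}E=0$. The eigenforms and eigenvalues are the following data (for $\varepsilon=\mu=\operatorname{id}$, where on the domain considered the embedding $R^{q,\Gamma_1}(S)\cap D^{q,\Gamma_2}(S)\hookrightarrow L_2^q(S)$ is compact): with $N^q=\dim(R_0^{q,\Gamma_1}(S)\cap D_0^{q,\Gamma_2}(S))$, a complete orthonormal system $\{E_n^q:n\in\mathbb N\}$ of $D_0^{q,\Gamma_2}(S)$, a complete orthonormal system $\{H_n^q:n>N^q\}$ of $\overline{\operatorname{rot}R^{q,\Gamma_1}(S)}$, and a sequence $\omega_n^q\in(0,\infty)$, $n>N^q$, with $\omega_n^q\to\infty$, such that $E_n^q\in R_0^{q,\Gamma_1}(S)\cap D_0^{q,\Gamma_2}(S)$ for $n\le N^q$, and for $n>N^q$: $(E_n^q,H_n^q)\in R^{q,\Gamma_1}(S)\times D^{q+1,\Gamma_2}(S)$, $\operatorname{rot}E_n^q+i\omega_n^qH_n^q=0$, $\operatorname{div}H_n^q+i\omega_n^qE_n^q=0$ (finite or empty systems allowed). The superscript $1$ in $E_n^{1,q}$ etc. indicates the dimension. For $q=0$ on the half circle, $N^0=0$. "Up to normalizing constants" means after multiplication of each pair $(E_n,H_n)$ by a suitable constant the displayed forms give such a system. *)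

theory Defs
  imports "HOL-Analysis.Analysis"
begin

text \<open>
  Forms on (subsets of) the unit circle in the plane are given in the angular coordinate
  \<open>\<phi>\<close>: a \<open>0\<close>-form \<open>e(\<phi>)\<close> and a \<open>1\<close>-form \<open>h(\<phi>) d\<phi>\<close> are both represented by their coefficient
  function \<open>real \<Rightarrow> complex\<close>. The degree \<open>q :: int\<close> is carried separately, and forms of degree
  outside \<open>{0, 1}\<close> are zero. Since \<open>d\<phi>\<close> is the unit volume form, \<open>*1 = d\<phi>\<close> and \<open>*d\<phi> = 1\<close>, so
  the inner product has the same expression in degrees \<open>0\<close> and \<open>1\<close>, and the sign in
  \<open>div = (-1)^(q - 1) *d*\<close> is \<open>+1\<close> for \<open>q = 1\<close>, the only degree with nonzero divergence.
  Elements of \<open>L\<^sub>2\<close> are represented by functions, not by almost-everywhere classes.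
\<close>

definition circle_point :: "real \<Rightarrow> real \<times> real" where
  "circle_point \<phi> = (cos \<phi>, sin \<phi>)"

text \<open>Arc length on a subset \<open>S\<close> of the circle, in the coordinate \<open>\<phi> \<in> (-\<pi>, \<pi>]\<close>.\<close>

definition arc_measure :: "(real \<times> real) set \<Rightarrow> real measure" where
  "arc_measure S = lebesgue_on {\<phi> \<in> {- pi<..pi}. circle_point \<phi> \<in> S}"

definition L2_forms :: "(real \<times> real) set \<Rightarrow> int \<Rightarrow> (real \<Rightarrow> complex) set" where
  "L2_forms S q = {f. f \<in> borel_measurable (arc_measure S) \<and>
     integrable (arc_measure S) (\<lambda>\<phi>. (cmod (f \<phi>))\<^sup>2) \<and>
     (q \<notin> {0, 1} \<longrightarrow> (\<forall>\<phi>. circle_point \<phi> \<in> S \<longrightarrow> f \<phi> = 0))}"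

definition L2_inner :: "(real \<times> real) set \<Rightarrow> (real \<Rightarrow> complex) \<Rightarrow> (real \<Rightarrow> complex) \<Rightarrow> complex" where
  "L2_inner S f g = (LINT \<phi>|arc_measure S. f \<phi> * cnj (g \<phi>))"

definition L2_norm :: "(real \<times> real) set \<Rightarrow> (real \<Rightarrow> complex) \<Rightarrow> real" where
  "L2_norm S f = sqrt (LINT \<phi>|arc_measure S. (cmod (f \<phi>))\<^sup>2)"

definition smooth_fun :: "(real \<Rightarrow> complex) \<Rightarrow> bool" where
  "smooth_fun f \<longleftrightarrow> (\<exists>D :: nat \<Rightarrow> real \<Rightarrow> complex. D 0 = f \<and>
     (\<forall>k x. (D k has_vector_derivative D (Suc k) x) (at x)))"

definition smooth_circle_forms :: "int \<Rightarrow> (real \<Rightarrow> complex) set" where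
  "smooth_circle_forms q = {\<Psi>. smooth_fun \<Psi> \<and> (\<forall>\<phi>. \<Psi> (\<phi> + 2 * pi) = \<Psi> \<phi>) \<and>
     (q \<notin> {0, 1} \<longrightarrow> (\<forall>\<phi>. \<Psi> \<phi> = 0))}"

definition form_support :: "(real \<Rightarrow> complex) \<Rightarrow> (real \<times> real) set" where
  "form_support \<Psi> = closure {circle_point \<phi> |\<phi>. \<Psi> \<phi> \<noteq> 0}"

text \<open>Positive distance is spelled out because \<^const>\<open>setdist\<close> is \<open>0\<close> if one of the sets is empty.\<close>

definition smooth_forms_off ::
    "(real \<times> real) set \<Rightarrow> int \<Rightarrow> (real \<times> real) set \<Rightarrow> (real \<Rightarrow> complex) set" where
  "smooth_forms_off S q \<Gamma> = {\<Phi>. \<exists>\<Psi> \<in> smooth_circle_forms q.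
     (\<exists>\<delta>>0. \<forall>x \<in> form_support \<Psi>. \<forall>y \<in> \<Gamma>. \<delta> \<le> dist x y) \<and>
     (\<forall>\<phi>. circle_point \<phi> \<in> S \<longrightarrow> \<Phi> \<phi> = \<Psi> \<phi>)}"

definition compactly_supported_forms ::
    "(real \<times> real) set \<Rightarrow> int \<Rightarrow> (real \<Rightarrow> complex) set" where
  "compactly_supported_forms S q = {\<Psi> \<in> smooth_circle_forms q. form_support \<Psi> \<subseteq> S}"

definition smooth_rot :: "int \<Rightarrow> (real \<Rightarrow> complex) \<Rightarrow> real \<Rightarrow> complex" where
  "smooth_rot q \<Phi> \<phi> = (if q = 0 then vector_derivative \<Phi> (at \<phi>) else 0)"

definition smooth_div :: "int \<Rightarrow> (real \<Rightarrow> complex) \<Rightarrow> real \<Rightarrow> complex" where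
  "smooth_div q \<Phi> \<phi> = (if q = 1 then vector_derivative \<Phi> (at \<phi>) else 0)"

text \<open>\<open>has_rot S q E F\<close>: the \<open>q\<close>-form \<open>E\<close> has the distributional exterior derivative \<open>F\<close>,
  both in \<open>L\<^sub>2\<close>. The form \<open>F\<close> is unique up to null sets.\<close>

definition has_rot ::
    "(real \<times> real) set \<Rightarrow> int \<Rightarrow> (real \<Rightarrow> complex) \<Rightarrow> (real \<Rightarrow> complex) \<Rightarrow> bool" where
  "has_rot S q E F \<longleftrightarrow> E \<in> L2_forms S q \<and> F \<in> L2_forms S (q + 1) \<and>
     (\<forall>\<Phi> \<in> compactly_supported_forms S (q + 1).
        L2_inner S E (smooth_div (q + 1) \<Phi>) = - L2_inner S F \<Phi>)"

definition has_div ::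
    "(real \<times> real) set \<Rightarrow> int \<Rightarrow> (real \<Rightarrow> complex) \<Rightarrow> (real \<Rightarrow> complex) \<Rightarrow> bool" where
  "has_div S q E F \<longleftrightarrow> E \<in> L2_forms S q \<and> F \<in> L2_forms S (q - 1) \<and>
     (\<forall>\<Phi> \<in> compactly_supported_forms S (q - 1).
        L2_inner S E (smooth_rot (q - 1) \<Phi>) = - L2_inner S F \<Phi>)"

text \<open>The boundary condition of \<open>R\<close> on \<open>\<Gamma>\<^sub>1\<close> is encoded by test forms vanishing near \<open>\<Gamma>\<^sub>2\<close>, the
  remaining part of the boundary; likewise for \<open>D\<close> with the roles exchanged. This is why \<open>R_space\<close>
  takes \<open>\<Gamma>\<^sub>2\<close> as its argument and \<open>D_space\<close> takes \<open>\<Gamma>\<^sub>1\<close>.\<close>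

definition R_space ::
    "(real \<times> real) set \<Rightarrow> (real \<times> real) set \<Rightarrow> int \<Rightarrow> (real \<Rightarrow> complex) set" where
  "R_space S \<Gamma>2 q = {E. \<exists>F. has_rot S q E F \<and>
     (\<forall>\<Phi> \<in> smooth_forms_off S (q + 1) \<Gamma>2.
        L2_inner S E (smooth_div (q + 1) \<Phi>) = - L2_inner S F \<Phi>)}"

definition D_space ::
    "(real \<times> real) set \<Rightarrow> (real \<times> real) set \<Rightarrow> int \<Rightarrow> (real \<Rightarrow> complex) set" where
  "D_space S \<Gamma>1 q = {E. \<exists>F. has_div S q E F \<and>
     (\<forall>\<Phi> \<in> smooth_forms_off S (q - 1) \<Gamma>1.
        L2_inner S E (smooth_rot (q - 1) \<Phi>) = - L2_inner S F \<Phi>)}"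

definition R0_space ::
    "(real \<times> real) set \<Rightarrow> (real \<times> real) set \<Rightarrow> int \<Rightarrow> (real \<Rightarrow> complex) set" where
  "R0_space S \<Gamma>2 q = {E \<in> R_space S \<Gamma>2 q. has_rot S q E (\<lambda>_. 0)}"

definition D0_space ::
    "(real \<times> real) set \<Rightarrow> (real \<times> real) set \<Rightarrow> int \<Rightarrow> (real \<Rightarrow> complex) set" where
  "D0_space S \<Gamma>1 q = {E \<in> D_space S \<Gamma>1 q. has_div S q E (\<lambda>_. 0)}"

definition rot_R ::
    "(real \<times> real) set \<Rightarrow> (real \<times> real) set \<Rightarrow> int \<Rightarrow> (real \<Rightarrow> complex) set" where
  "rot_R S \<Gamma>2 q = {F. \<exists>E \<in> R_space S \<Gamma>2 q. has_rot S q E F}"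

definition L2_closure ::
    "(real \<times> real) set \<Rightarrow> int \<Rightarrow> (real \<Rightarrow> complex) set \<Rightarrow> (real \<Rightarrow> complex) set" where
  "L2_closure S q V =
     {f \<in> L2_forms S q. \<forall>\<epsilon>>0. \<exists>g \<in> V. L2_norm S (\<lambda>\<phi>. f \<phi> - g \<phi>) < \<epsilon>}"

text \<open>Complex dimension of a space of forms modulo null functions.\<close>

definition L2_dim :: "(real \<times> real) set \<Rightarrow> (real \<Rightarrow> complex) set \<Rightarrow> enat" where
  "L2_dim S V = Sup {enat N |N. \<exists>B :: nat \<Rightarrow> real \<Rightarrow> complex. (\<forall>k<N. B k \<in> V) \<and>
     (\<forall>a :: nat \<Rightarrow> complex. (AE \<phi> in arc_measure S. (\<Sum>k<N. a k * B k \<phi>) = 0)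
        \<longrightarrow> (\<forall>k<N. a k = 0))}"

definition complete_orthonormal_system ::
    "(real \<times> real) set \<Rightarrow> (real \<Rightarrow> complex) set \<Rightarrow> nat set \<Rightarrow> (nat \<Rightarrow> real \<Rightarrow> complex) \<Rightarrow> bool" where
  "complete_orthonormal_system S V J e \<longleftrightarrow>
     (\<forall>n \<in> J. e n \<in> V) \<and>
     (\<forall>m \<in> J. \<forall>n \<in> J. L2_inner S (e m) (e n) = (if m = n then 1 else 0)) \<and>
     (\<forall>f \<in> V. \<forall>\<epsilon>>0. \<exists>T c. finite T \<and> T \<subseteq> J \<and>
        L2_norm S (\<lambda>\<phi>. f \<phi> - (\<Sum>n\<in>T. c n * e n \<phi>)) < \<epsilon>)"

definition harmonic_dim ::
    "(real \<times> real) set \<Rightarrow> (real \<times> real) set \<Rightarrow> (real \<times> real) set \<Rightarrow> int \<Rightarrow> enat" where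
  "harmonic_dim S \<Gamma>1 \<Gamma>2 q = L2_dim S (R0_space S \<Gamma>2 q \<inter> D0_space S \<Gamma>1 q)"

text \<open>
  \<open>maxwell_system S \<Gamma>1 \<Gamma>2 q I E H \<omega>\<close>: the families \<open>E\<close>, \<open>H\<close>, \<open>\<omega>\<close> are eigenforms and eigenvalues of
  the Maxwell system on \<open>(S, \<Gamma>1, \<Gamma>2)\<close> for \<open>q\<close>-forms. The index set \<open>I\<close> is an initial segment of
  \<open>{1, 2, \<dots>}\<close>, possibly finite or empty; \<open>E\<close> is indexed by \<open>I\<close>, while \<open>H\<close> and \<open>\<omega>\<close> are indexed by
  \<open>{n \<in> I. n > N}\<close> with \<open>N\<close> the dimension of the harmonic forms.
\<close>

definition maxwell_system ::
    "(real \<times> real) set \<Rightarrow> (real \<times> real) set \<Rightarrow> (real \<times> real) set \<Rightarrow> int \<Rightarrow> nat set \<Rightarrow>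
     (nat \<Rightarrow> real \<Rightarrow> complex) \<Rightarrow> (nat \<Rightarrow> real \<Rightarrow> complex) \<Rightarrow> (nat \<Rightarrow> real) \<Rightarrow> bool" where
  "maxwell_system S \<Gamma>1 \<Gamma>2 q I E H \<omega> \<longleftrightarrow>
     (let N = harmonic_dim S \<Gamma>1 \<Gamma>2 q; J = {n \<in> I. enat n > N} in
       0 \<notin> I \<and> (\<forall>n \<in> I. {1..n} \<subseteq> I) \<and>
       complete_orthonormal_system S (D0_space S \<Gamma>1 q) I E \<and>
       complete_orthonormal_system S (L2_closure S (q + 1) (rot_R S \<Gamma>2 q)) J H \<and>
       (\<forall>n \<in> J. \<omega> n > 0) \<and> (infinite J \<longrightarrow> filterlim \<omega> at_top sequentially) \<and>
       (\<forall>n \<in> I - J. E n \<in> R0_space S \<Gamma>2 q \<inter> D0_space S \<Gamma>1 q) \<and>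
       (\<forall>n \<in> J. E n \<in> R_space S \<Gamma>2 q \<and> H n \<in> D_space S \<Gamma>1 (q + 1) \<and>
          has_rot S q (E n) (\<lambda>\<phi>. - (\<i> * of_real (\<omega> n) * H n \<phi>)) \<and>
          has_div S (q + 1) (H n) (\<lambda>\<phi>. - (\<i> * of_real (\<omega> n) * E n \<phi>))))"

end

theory Submission
  imports Defs
begin

text \<open>
  In degree \<open>0\<close> every form is divergence free, so the issue is completeness. The half-angle cosines span
  \<open>cos (\<phi>/2)\<close> times the polynomials in \<open>cos \<phi>\<close>, and the half-angle sines span \<open>sin (\<phi>/2)\<close> times these
  polynomials; by the Weierstrass theorem in the variable \<open>cos \<phi>\<close> such products are dense in \<open>L\<^sub>2\<close>
  for any continuous weight without zeros in \<open>(0, \<pi>)\<close>. In degree \<open>1\<close> a divergence-free form with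
  the boundary condition is orthogonal to \<open>\<Phi>'\<close> for all test forms \<open>\<Phi>\<close> vanishing near \<open>\<phi> = \<pi>\<close>; these
  derivatives include a cutoff times \<open>sin \<phi> cos\<^sup>k \<phi>\<close> for every \<open>k\<close>, so the form is zero by the same
  density. The reflected argument shows that there are no harmonic forms in degree \<open>0\<close>.
\<close>

subsection \<open>Smooth cutoff functions\<close>

text \<open>No spectral theorem or compact embedding enters: completeness is checked for each system
  directly, and vanishing is obtained as orthogonality to a dense set, so one density result serves
  both purposes. The variable \<open>cos \<phi>\<close> fits because every function of it is
  automatically \<open>2 * pi\<close>-periodic, hence a form on the whole circle, while it is
  injective on the closed interval from 0 to \<open>pi\<close>, so that Weierstrass applies there.
  Two obstacles shape the rest. Membership in \<open>R\<close> or \<open>D\<close> supplies some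
  weak derivative, whereas the lower index 0 asserts that zero is one; the two must be identified
  almost everywhere by compactly supported tests before the boundary condition can be exploited.
  Moreover, a monomial in \<open>cos \<phi>\<close> does not vanish near an endpoint, so the tests
  need flat smooth cutoffs. These are removed at the end by letting the excluded neighbourhood
  shrink along a sequence.\<close>

definition bump :: "nat \<Rightarrow> real \<Rightarrow> real" where
  "bump n x = (if x > 0 then (1 / x) ^ n * exp (- (1 / x)) else 0)"

lemma bump_tendsto_0: "(bump n \<longlongrightarrow> 0) (at 0)"
proof -
  have "((\<lambda>x. inverse x ^ n / exp (inverse x)) \<longlongrightarrow> 0) (at_right (0::real))"
    by (rule filterlim_compose[OF tendsto_power_div_exp_0 filterlim_inverse_at_top_right])
  then have "(bump n \<longlongrightarrow> 0) (at_right 0)"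
    by (rule Lim_transform_eventually)
       (auto simp: eventually_at_filter bump_def exp_minus divide_inverse)
  moreover have "(bump n \<longlongrightarrow> 0) (at_left 0)"
    by (rule tendsto_eventually) (auto simp: eventually_at_filter bump_def)
  ultimately show ?thesis
    by (simp add: filterlim_split_at)
qed

text \<open>The powers of \<open>1 / x\<close> in \<open>bump\<close> are there for this formula:
  starting from the classical flat function \<open>bump 0\<close>, differentiation never leaves the
  linear span of the family.\<close>

lemma bump_has_derivative:
  "(bump n has_real_derivative - (real n * bump (Suc n) x) + bump (Suc (Suc n)) x) (at x)"
proof (cases "x = 0")
  case True
  \<comment> \<open>The difference quotient of \<open>bump n\<close> at 0 is exactly
    \<open>bump (Suc n)\<close>, so flatness of the next member gives the derivative.\<close>
  have "((\<lambda>h. (bump n (0 + h) - bump n 0) / h) \<longlongrightarrow> 0) (at 0)"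
    by (rule Lim_transform_eventually[OF bump_tendsto_0[of "Suc n"]])
       (auto simp: eventually_at_filter bump_def)
  with True show ?thesis
    by (simp add: DERIV_def bump_def)
next
  case False
  show ?thesis
  proof (cases "x > 0")
    case True
    have pow: "((\<lambda>x. (1 / x) ^ n) has_real_derivative - (real n * (1 / x) ^ Suc n)) (at x)"
    proof (induction n)
      case (Suc n)
      have "((\<lambda>x. 1 / x) has_real_derivative - ((1 / x) ^ 2)) (at x)"
        using True by (auto intro!: derivative_eq_intros simp: power2_eq_square)
      from DERIV_mult[OF this Suc.IH] show ?case
        unfolding power_Suc by (rule DERIV_cong) (simp add: field_simps power2_eq_square, simp add: add_divide_distrib)
    qed simp
    have "((\<lambda>x. exp (- (1 / x))) has_real_derivative (1 / x) ^ 2 * exp (- (1 / x))) (at x)"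
      using True by (auto intro!: derivative_eq_intros simp: power2_eq_square)
    from DERIV_mult[OF pow this]
    have "((\<lambda>x. (1 / x) ^ n * exp (- (1 / x))) has_real_derivative
        - (real n * bump (Suc n) x) + bump (Suc (Suc n)) x) (at x)"
      using True by (simp add: bump_def algebra_simps power2_eq_square)
    then show ?thesis
      by (rule has_field_derivative_transform_within_open[of _ _ _ "{0<..}"])
         (use True in \<open>auto simp: bump_def\<close>)
  next
    case False
    with \<open>x \<noteq> 0\<close> have "x < 0" by simp
    have "((\<lambda>x. 0) has_real_derivative
        - (real n * bump (Suc n) x) + bump (Suc (Suc n)) x) (at x)"
      using \<open>x < 0\<close> by (simp add: bump_def)
    then show ?thesis
      by (rule has_field_derivative_transform_within_open[of _ _ _ "{..<0}"])
         (use \<open>x < 0\<close> in \<open>auto simp: bump_def\<close>)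
  qed
qed

lemma bump_0_pos: "x > 0 \<Longrightarrow> bump 0 x > 0"
  and bump_eq_0: "x \<le> 0 \<Longrightarrow> bump n x = 0"
  by (auto simp: bump_def)

lemma continuous_on_bump [continuous_intros]:
  assumes "continuous_on S f" shows "continuous_on S (\<lambda>x. bump n (f x))"
proof -
  have "continuous_on UNIV (bump n)"
    by (meson DERIV_isCont bump_has_derivative continuous_at_imp_continuous_on)
  then show ?thesis
    using assms by (rule continuous_on_compose2) auto
qed

text \<open>Closed under differentiation by construction, so membership yields all derivatives at once.\<close>

inductive smooth_real :: "(real \<Rightarrow> real) \<Rightarrow> bool" where
  const: "smooth_real (\<lambda>_. a)"
| sin: "smooth_real sin"
| cos: "smooth_real cos"
| bump: "smooth_real (bump n)"
| add: "smooth_real f \<Longrightarrow> smooth_real g \<Longrightarrow> smooth_real (\<lambda>x. f x + g x)"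
| mult: "smooth_real f \<Longrightarrow> smooth_real g \<Longrightarrow> smooth_real (\<lambda>x. f x * g x)"
| comp: "smooth_real f \<Longrightarrow> smooth_real g \<Longrightarrow> smooth_real (\<lambda>x. f (g x))"
| antideriv: "smooth_real f \<Longrightarrow> (\<And>x. (g has_real_derivative f x) (at x)) \<Longrightarrow> smooth_real g"

lemma smooth_real_id: "smooth_real (\<lambda>x. x)"
  by (rule smooth_real.antideriv[OF smooth_real.const[of 1]]) simp

lemma smooth_real_power: "smooth_real f \<Longrightarrow> smooth_real (\<lambda>x. f x ^ n)"
  by (induction n) (auto intro: smooth_real.intros)

lemma smooth_real_deriv:
  "smooth_real f \<Longrightarrow> \<exists>f'. smooth_real f' \<and> (\<forall>x. (f has_real_derivative f' x) (at x))"
proof (induction rule: smooth_real.induct)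
  case (const a)
  then show ?case
    by (intro exI[of _ "\<lambda>_. 0"]) (auto intro: smooth_real.intros)
next
  case sin
  then show ?case
    by (intro exI[of _ cos]) (auto intro: smooth_real.intros DERIV_sin)
next
  case cos
  have "smooth_real (\<lambda>x. (-1) * sin x)"
    by (intro smooth_real.intros)
  then show ?case
    by (intro exI[of _ "\<lambda>x. (-1) * sin x"]) (auto intro!: derivative_eq_intros)
next
  case (bump n)
  have "smooth_real (\<lambda>x. (- real n) * bump (Suc n) x + bump (Suc (Suc n)) x)"
    by (intro smooth_real.intros)
  then show ?case
    using bump_has_derivative[of n] by (intro exI[of _ "\<lambda>x. (- real n) * bump (Suc n) x + bump (Suc (Suc n)) x"]) auto
next
  case (add f g)
  then obtain f' g' where "smooth_real f'" "\<And>x. (f has_real_derivative f' x) (at x)"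
      "smooth_real g'" "\<And>x. (g has_real_derivative g' x) (at x)"
    by blast
  then show ?case
    by (intro exI[of _ "\<lambda>x. f' x + g' x"]) (auto intro: smooth_real.intros derivative_intros)
next
  case (mult f g)
  then obtain f' g' where "smooth_real f'" "\<And>x. (f has_real_derivative f' x) (at x)"
      "smooth_real g'" "\<And>x. (g has_real_derivative g' x) (at x)"
    by blast
  with mult.hyps show ?case
    by (intro exI[of _ "\<lambda>x. f' x * g x + g' x * f x"]) (auto intro: smooth_real.intros derivative_intros)
next
  case (comp f g)
  then obtain f' g' where "smooth_real f'" "\<And>x. (f has_real_derivative f' x) (at x)"
      "smooth_real g'" "\<And>x. (g has_real_derivative g' x) (at x)"
    by blast
  with comp.hyps show ?case
    by (intro exI[of _ "\<lambda>x. f' (g x) * g' x"]) (auto intro: smooth_real.intros DERIV_chain2)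
next
  case (antideriv f g)
  then show ?case by blast
qed

lemma smooth_real_imp_smooth_fun:
  assumes "smooth_real f" shows "smooth_fun (\<lambda>x. of_real (f x))"
proof -
  \<comment> \<open>A choice of derivative within the class turns differentiation into an operator
    \<open>d\<close>; its iterates are the witness for \<open>smooth_fun\<close>.\<close>
  obtain d where d: "\<And>f. smooth_real f \<Longrightarrow>
      smooth_real (d f) \<and> (\<forall>x. (f has_real_derivative d f x) (at x))"
    using smooth_real_deriv by metis
  have *: "smooth_real ((d ^^ k) f)" for k
    using assms d by (induction k) auto
  show ?thesis
    unfolding smooth_fun_def
  proof (intro exI[of _ "\<lambda>k x. of_real ((d ^^ k) f x)"] conjI allI)
    fix k x
    have "((d ^^ k) f has_real_derivative (d ^^ Suc k) f x) (at x)"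
      using d[OF *[of k]] by simp
    then show "((\<lambda>x. complex_of_real ((d ^^ k) f x)) has_vector_derivative
        of_real ((d ^^ Suc k) f x)) (at x)"
      by (intro has_vector_derivative_of_real)
         (simp add: has_real_derivative_iff_has_vector_derivative)
  qed simp
qed

lemma smooth_real_antiderivative:
  assumes f: "smooth_real f" and z: "\<And>y. y \<le> a \<Longrightarrow> f y = 0"
  obtains g where "smooth_real g" "\<And>x. (g has_real_derivative f x) (at x)"
    "\<And>x. x \<le> a \<Longrightarrow> g x = 0"
proof -
  have cont: "continuous_on S f" for S
    by (meson DERIV_isCont f continuous_at_imp_continuous_on smooth_real_deriv)
  \<comment> \<open>The base point lies strictly left of \<open>a\<close>: for
    \<open>x \<ge> a\<close> the point \<open>x\<close> is then interior to the interval used for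
    the fundamental theorem, and for \<open>x \<le> a\<close> only zeros of \<open>f\<close> are
    integrated.\<close>
  define g where "g x = integral {a - 1..x} f" for x
  have g0: "g x = 0" if "x \<le> a" for x
    unfolding g_def using z that integral_cong[of "{a - 1..x}" f "\<lambda>_. 0"] by simp
  have "(g has_real_derivative f x) (at x)" for x
  proof (cases "x < a")
    case True
    have "((\<lambda>x. 0) has_real_derivative f x) (at x)"
      using z True by simp
    then show ?thesis
      by (rule has_field_derivative_transform_within_open[of _ _ _ "{..<a}"])
         (use True g0 in auto)
  next
    case False
    have "(g has_real_derivative f x) (at x within {a - 1..x + 1})"
      unfolding g_def using False by (intro integral_has_real_derivative cont) auto
    then show ?thesis
      using False by (simp add: at_within_Icc_at)
  qed
  with g0 smooth_real.antideriv[OF f] that show thesis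
    by blast
qed

subsection \<open>Density of weighted cosine polynomials\<close>

abbreviation half_measure :: "real measure" where
  "half_measure \<equiv> lebesgue_on {0<..<pi}"

lemma finite_half_measure: "finite_measure half_measure"
  by (rule finite_measure_lebesgue_on) simp

lemma borel_measurable_half:
  "continuous_on {0<..<pi} f \<Longrightarrow> f \<in> borel_measurable half_measure"
  by (rule continuous_imp_measurable_on_sets_lebesgue) auto

text \<open>Polymorphic in the codomain, since approximation is carried out for real functions and
  transferred to complex ones through real and imaginary parts.\<close>

definition sq_int :: "(real \<Rightarrow> 'a::euclidean_space) \<Rightarrow> bool" where
  "sq_int f \<longleftrightarrow> f \<in> borel_measurable half_measure \<and> integrable half_measure (\<lambda>x. (norm (f x))\<^sup>2)"

lemma sq_int_bounded:
  assumes "f \<in> borel_measurable half_measure" "\<And>x. x \<in> {0<..<pi} \<Longrightarrow> norm (f x) \<le> B"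
  shows "sq_int f" "integrable half_measure f"
proof -
  interpret finite_measure half_measure by (rule finite_half_measure)
  show "integrable half_measure f"
    using assms by (intro integrable_const_bound[where B = B]) (auto intro!: AE_I2)
  have "integrable half_measure (\<lambda>x. (norm (f x))\<^sup>2)"
    using assms by (intro integrable_const_bound[where B = "B\<^sup>2"])
      (auto intro!: AE_I2 power_mono)
  with assms show "sq_int f" by (simp add: sq_int_def)
qed

lemma bounded_continuous_half:
  fixes f :: "real \<Rightarrow> 'a::euclidean_space"
  assumes "continuous_on {0..pi} f"
  obtains B where "B > 0" "\<And>x. x \<in> {0..pi} \<Longrightarrow> norm (f x) \<le> B"
  using compact_imp_bounded[OF compact_continuous_image[OF assms]]
  by (auto simp: bounded_pos)

lemma continuous_half:
  fixes f :: "real \<Rightarrow> 'a::euclidean_space"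
  assumes "continuous_on {0..pi} f"
  shows "f \<in> borel_measurable half_measure" "sq_int f" "integrable half_measure f"
proof -
  show m: "f \<in> borel_measurable half_measure"
    using assms by (intro borel_measurable_half) (rule continuous_on_subset, auto)
  obtain B where "\<And>x. x \<in> {0..pi} \<Longrightarrow> norm (f x) \<le> B"
    using bounded_continuous_half[OF assms] by blast
  then show "sq_int f" "integrable half_measure f"
    by (auto intro: sq_int_bounded[OF m, of B])
qed

lemma sq_int_integrable:
  assumes "sq_int f" shows "integrable half_measure f"
proof -
  interpret finite_measure half_measure by (rule finite_half_measure)
  have "norm (f x) \<le> norm (1 + (norm (f x))\<^sup>2)" for x
  proof -
    have "0 \<le> (norm (f x) - 1)\<^sup>2" "0 \<le> norm (f x)" by simp_all
    then have "2 * norm (f x) \<le> 1 + (norm (f x))\<^sup>2" "0 \<le> norm (f x)"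
      by (simp_all add: power2_diff)
    then have "norm (f x) \<le> 1 + (norm (f x))\<^sup>2"
      by linarith
    then show ?thesis by simp
  qed
  then show ?thesis
    using assms unfolding sq_int_def
    by (intro Bochner_Integration.integrable_bound[of _ "\<lambda>x. 1 + (norm (f x))\<^sup>2" f]) auto
qed

text \<open>A stand-in for the triangle inequality of the L2 norm: the factors 2 are paid for by
  smaller tolerances, and all estimates can be made for squared norms without roots.\<close>

lemma norm_add_square_le:
  "(norm (a + b))\<^sup>2 \<le> 2 * (norm a)\<^sup>2 + 2 * (norm (b::'a::real_normed_vector))\<^sup>2"
proof -
  have "(norm (a + b))\<^sup>2 \<le> (norm a + norm b)\<^sup>2"
    by (intro power_mono norm_triangle_ineq) simp
  also have "\<dots> \<le> 2 * (norm a)\<^sup>2 + 2 * (norm b)\<^sup>2"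
    using zero_le_power2[of "norm a - norm b"] by (simp add: power2_eq_square algebra_simps)
  finally show ?thesis .
qed

lemma sq_int_add:
  assumes "sq_int f" "sq_int g"
  shows "sq_int (\<lambda>x. f x + g x)"
    and "(LINT x|half_measure. (norm (f x + g x))\<^sup>2)
      \<le> 2 * (LINT x|half_measure. (norm (f x))\<^sup>2) + 2 * (LINT x|half_measure. (norm (g x))\<^sup>2)"
proof -
  have i: "integrable half_measure (\<lambda>x. 2 * (norm (f x))\<^sup>2 + 2 * (norm (g x))\<^sup>2)"
    using assms by (auto simp: sq_int_def)
  then have j: "integrable half_measure (\<lambda>x. (norm (f x + g x))\<^sup>2)"
    using assms norm_add_square_le[of "f _" "g _"]
    by (intro Bochner_Integration.integrable_bound[OF i]) (auto simp: sq_int_def intro!: AE_I2)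
  then show "sq_int (\<lambda>x. f x + g x)"
    using assms by (auto simp: sq_int_def)
  have "(LINT x|half_measure. (norm (f x + g x))\<^sup>2)
      \<le> (LINT x|half_measure. 2 * (norm (f x))\<^sup>2 + 2 * (norm (g x))\<^sup>2)"
    by (intro integral_mono j i norm_add_square_le)
  also have "\<dots> = 2 * (LINT x|half_measure. (norm (f x))\<^sup>2) + 2 * (LINT x|half_measure. (norm (g x))\<^sup>2)"
    using assms by (subst Bochner_Integration.integral_add) (auto simp: sq_int_def)
  finally show "(LINT x|half_measure. (norm (f x + g x))\<^sup>2)
      \<le> 2 * (LINT x|half_measure. (norm (f x))\<^sup>2) + 2 * (LINT x|half_measure. (norm (g x))\<^sup>2)" .
qed

lemma sq_int_mult_bounded:
  fixes f g :: "real \<Rightarrow> 'a::{real_normed_field, euclidean_space}"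
  assumes "sq_int f" and [measurable]: "g \<in> borel_measurable half_measure"
    and B: "\<And>x. x \<in> {0<..<pi} \<Longrightarrow> norm (g x) \<le> B"
  shows "sq_int (\<lambda>x. f x * g x)"
proof -
  have [measurable]: "f \<in> borel_measurable half_measure"
    and i: "integrable half_measure (\<lambda>x. (norm (f x))\<^sup>2)"
    using assms by (auto simp: sq_int_def)
  have "norm (f x * g x) ^ 2 \<le> norm ((norm (f x))\<^sup>2 * B\<^sup>2)" if "x \<in> {0<..<pi}" for x
    using power_mono[OF B[OF that], of 2]
    by (simp add: norm_mult power_mult_distrib mult_left_mono)
  then have "integrable half_measure (\<lambda>x. (norm (f x * g x))\<^sup>2)"
    by (intro Bochner_Integration.integrable_bound[OF integrable_mult_left[OF i, of "B\<^sup>2"]]) (auto intro!: AE_I2)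
  then show ?thesis
    by (simp add: sq_int_def)
qed

lemma sq_int_mult_continuous:
  fixes f g :: "real \<Rightarrow> 'a::{real_normed_field, euclidean_space}"
  assumes "sq_int f" "continuous_on {0..pi} g"
  shows "sq_int (\<lambda>x. f x * g x)" "integrable half_measure (\<lambda>x. f x * g x)"
proof -
  obtain B where "\<And>x. x \<in> {0..pi} \<Longrightarrow> norm (g x) \<le> B"
    using bounded_continuous_half[OF assms(2)] by blast
  then show "sq_int (\<lambda>x. f x * g x)"
    by (intro sq_int_mult_bounded[OF assms(1) continuous_half(1)[OF assms(2)], of B]) auto
  then show "integrable half_measure (\<lambda>x. f x * g x)"
    by (rule sq_int_integrable)
qed

lemma integral_half_FTC:
  fixes F f :: "real \<Rightarrow> complex"
  assumes "\<And>x. (F has_vector_derivative f x) (at x)" "continuous_on {0..pi} f"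
  shows "(LINT x|half_measure. f x) = F pi - F 0"
proof -
  have "(f has_integral (F pi - F 0)) {0..pi}"
    using assms by (intro fundamental_theorem_of_calculus) (auto intro: has_vector_derivative_at_within)
  then have "integral {0<..<pi} f = F pi - F 0"
    by (simp add: integral_open_interval_real[symmetric] integral_unique)
  then show ?thesis
    using continuous_half(3)[OF assms(2)] by (simp add: lebesgue_integral_eq_integral)
qed

section \<open>Approximation by a weight times a polynomial in the cosine\<close>

lemma clamp_approx:
  fixes f :: "real \<Rightarrow> real"
  assumes "sq_int f" "\<epsilon> > 0"
  obtains m where "m > 0" "(LINT x|half_measure. (f x - max (- m) (min m (f x)))\<^sup>2) < \<epsilon>"
    "sq_int (\<lambda>x. max (- m) (min m (f x)))" "sq_int (\<lambda>x. f x - max (- m) (min m (f x)))"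
proof -
  have [measurable]: "f \<in> borel_measurable half_measure"
    and i: "integrable half_measure (\<lambda>x. (f x)\<^sup>2)"
    using assms by (auto simp: sq_int_def)
  let ?d = "\<lambda>n x. f x - max (- real (Suc n)) (min (real (Suc n)) (f x))"
  \<comment> \<open>Truncation errors are dominated by \<open>f\<close> itself, and at each point
    they are exactly 0 from some level on; dominated convergence then applies with the square of
    \<open>f\<close> as bound.\<close>
  have le: "(?d n x)\<^sup>2 \<le> (f x)\<^sup>2" for n x
    by (rule abs_le_square_iff[THEN iffD1]) (auto simp: abs_if max_def min_def)
  have "(\<lambda>n. ?d n x) \<longlonglongrightarrow> 0" for x
  proof (rule tendsto_eventually)
    obtain N :: nat where "\<bar>f x\<bar> \<le> real N" using real_arch_simple by blast
    then show "\<forall>\<^sub>F n in sequentially. ?d n x = 0"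
      by (intro eventually_mono[OF eventually_ge_at_top[of N]]) auto
  qed
  then have "(\<lambda>n. LINT x|half_measure. (?d n x)\<^sup>2) \<longlonglongrightarrow> (LINT x|half_measure. 0\<^sup>2)"
    using le by (intro integral_dominated_convergence[OF _ _ i]) (auto intro!: AE_I2 tendsto_intros simp del: power_zero_numeral)
  then have "\<forall>\<^sub>F n in sequentially. (LINT x|half_measure. (?d n x)\<^sup>2) < \<epsilon>"
    using assms(2) by (intro order_tendstoD) auto
  then obtain n where n: "(LINT x|half_measure. (?d n x)\<^sup>2) < \<epsilon>"
    using eventually_happens'[OF sequentially_bot] by blast
  have "sq_int (\<lambda>x. max (- real (Suc n)) (min (real (Suc n)) (f x)))"
    by (rule sq_int_bounded(1)[where B = "real (Suc n)"]) (auto simp: abs_if max_def min_def)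
  moreover have "sq_int (?d n)"
    using le by (auto simp: sq_int_def intro!: Bochner_Integration.integrable_bound[OF i] AE_I2)
  ultimately show thesis
    using that[of "real (Suc n)"] n by auto
qed

text \<open>The quotient of \<open>f\<close> by \<open>w\<close> need not be bounded, because
  \<open>w\<close> may vanish at the endpoints, as the half-angle sine and cosine do. Replacing
  \<open>1 / w\<close> by \<open>w / (w^2 + 1/(n+1))\<close> gives a function continuous up to the
  boundary, while multiplication by \<open>w\<close> still leaves a factor between 0 and 1 that
  tends to 1 wherever \<open>w\<close> is nonzero.\<close>

lemma weighted_continuous_approx:
  fixes f w :: "real \<Rightarrow> real"
  assumes [measurable]: "f \<in> borel_measurable half_measure" and m: "\<And>x. \<bar>f x\<bar> \<le> m"
    and w: "continuous_on {0..pi} w" "\<And>x. x \<in> {0<..<pi} \<Longrightarrow> w x \<noteq> 0" and "\<epsilon> > 0"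
  obtains k where "continuous_on {0..pi} k" "(LINT x|half_measure. (f x - w x * k x)\<^sup>2) < \<epsilon>"
proof -
  have "f measurable_on {0<..<pi}"
    by (simp add: measurable_on_iff_borel_measurable)
  \<comment> \<open>Lebesgue measurability in the form of continuous approximants \<open>h n\<close>
    converging off a null set. Clamping them to the bound \<open>m\<close> of \<open>f\<close> keeps
    the limit and makes a constant an integrable majorant.\<close>
  then obtain N h where N: "negligible N" and h: "\<And>n. continuous_on UNIV (h n)"
    and lim: "\<And>x. x \<notin> N \<Longrightarrow> (\<lambda>n. h n x) \<longlonglongrightarrow> (if x \<in> {0<..<pi} then f x else 0)"
    unfolding measurable_on_def by blast
  define k where "k n x = max (- m) (min m (h n x)) * w x / ((w x)\<^sup>2 + inverse (real (Suc n)))" for n x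
  have pos: "(w x)\<^sup>2 + inverse (real (Suc n)) > 0" for n x
    by (intro add_nonneg_pos) auto
  have k: "continuous_on {0..pi} (k n)" for n
    unfolding k_def using pos[of _ n]
    by (intro continuous_intros w continuous_on_subset[OF h]) (auto simp: less_imp_neq[symmetric])
  have wk: "w x * k n x = max (- m) (min m (h n x)) * ((w x)\<^sup>2 / ((w x)\<^sup>2 + inverse (real (Suc n))))" for n x
    by (simp add: k_def power2_eq_square)
  have m0: "0 \<le> m" using m[of 0] by linarith
  have bd: "\<bar>w x * k n x\<bar> \<le> m" for n x
  proof -
    have "\<bar>max (- m) (min m (h n x))\<bar> \<le> m" using m0 by auto
    moreover have "\<bar>(w x)\<^sup>2 / ((w x)\<^sup>2 + inverse (real (Suc n)))\<bar> \<le> 1"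
      using pos[of x n] by simp
    ultimately have "\<bar>max (- m) (min m (h n x))\<bar> * \<bar>(w x)\<^sup>2 / ((w x)\<^sup>2 + inverse (real (Suc n)))\<bar> \<le> m * 1"
      by (intro mult_mono m0) auto
    then show ?thesis
      unfolding wk abs_mult by simp
  qed
  have lim': "(\<lambda>n. f x - w x * k n x) \<longlonglongrightarrow> 0" if x: "x \<in> {0<..<pi}" "x \<notin> N" for x
  proof -
    have "(\<lambda>n. max (- m) (min m (h n x))) \<longlonglongrightarrow> max (- m) (min m (f x))"
      using lim[OF x(2)] x(1) by (intro tendsto_intros) auto
    moreover have "max (- m) (min m (f x)) = f x"
      using m[of x] by auto
    moreover have "(\<lambda>n. (w x)\<^sup>2 / ((w x)\<^sup>2 + inverse (real (Suc n)))) \<longlonglongrightarrow> (w x)\<^sup>2 / ((w x)\<^sup>2 + 0)"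
      using w(2)[OF x(1)] by (intro tendsto_intros LIMSEQ_inverse_real_of_nat) auto
    ultimately have "(\<lambda>n. w x * k n x) \<longlonglongrightarrow> f x * 1"
      unfolding wk using w(2)[OF x(1)] by (intro tendsto_mult) auto
    from tendsto_diff[OF tendsto_const[of "f x"] this] show ?thesis
      by simp
  qed
  have meas: "(\<lambda>x. w x * k n x) \<in> borel_measurable half_measure" for n
    by (intro continuous_half(1) continuous_intros w k)
  have "(\<lambda>n. LINT x|half_measure. (f x - w x * k n x)\<^sup>2) \<longlonglongrightarrow> (LINT x|half_measure. 0\<^sup>2)"
  proof (rule integral_dominated_convergence[where w = "\<lambda>_. (2 * m)\<^sup>2"])
    interpret finite_measure half_measure by (rule finite_half_measure)
    show "integrable half_measure (\<lambda>_. (2 * m)\<^sup>2)" by simp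
    have "\<bar>f x - w x * k n x\<bar> \<le> 2 * m" for x n
      using m[of x] bd[of x n] by linarith
    then have "(f x - w x * k n x)\<^sup>2 \<le> (2 * m)\<^sup>2" for x n
      using power_mono[of "\<bar>f x - w x * k n x\<bar>" "2 * m" 2] by simp
    then show "AE x in half_measure. norm ((f x - w x * k n x)\<^sup>2) \<le> (2 * m)\<^sup>2" for n
      by (auto intro!: AE_I2)
    have "AE x in half_measure. x \<notin> N"
      using N by (auto simp: AE_restrict_space_iff negligible_iff_null_sets
          intro!: AE_I'[of N lebesgue])
    then show "AE x in half_measure. (\<lambda>n. (f x - w x * k n x)\<^sup>2) \<longlonglongrightarrow> 0\<^sup>2"
      using AE_space by eventually_elim (auto intro!: tendsto_power lim' simp del: power_zero_numeral)
    show "(\<lambda>x. (f x - w x * k n x)\<^sup>2) \<in> borel_measurable half_measure" for n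
      by (intro borel_measurable_power borel_measurable_diff assms(1) meas)
  qed auto
  then have "\<forall>\<^sub>F n in sequentially. (LINT x|half_measure. (f x - w x * k n x)\<^sup>2) < \<epsilon>"
    using assms(5) by (intro order_tendstoD) auto
  then obtain n where "(LINT x|half_measure. (f x - w x * k n x)\<^sup>2) < \<epsilon>"
    using eventually_happens'[OF sequentially_bot] by blast
  with that[OF k] show thesis
    by blast
qed

lemma continuous_on_polynomial_cos:
  fixes p :: "real \<Rightarrow> real"
  assumes "real_polynomial_function p" shows "continuous_on S (\<lambda>x. p (cos x))"
proof -
  have "continuous_on UNIV p"
    by (intro continuous_at_imp_continuous_on ballI continuous_real_polymonial_function assms)
  then show ?thesis
    by (rule continuous_on_compose2) (auto intro: continuous_on_cos continuous_on_id)
qed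

text \<open>Three errors are added: truncation, division by the weight, and Weierstrass
  approximation after the substitution \<open>u = cos x\<close>. The square of the sum is bounded
  with weights 2, 4 and 4.\<close>

lemma polynomial_cos_approx:
  fixes f w :: "real \<Rightarrow> real"
  assumes f: "sq_int f"
    and w: "continuous_on {0..pi} w" "\<And>x. x \<in> {0<..<pi} \<Longrightarrow> w x \<noteq> 0" and "\<epsilon> > 0"
  obtains p where "real_polynomial_function p"
    "(LINT x|half_measure. (f x - w x * p (cos x))\<^sup>2) < \<epsilon>"
proof -
  \<comment> \<open>The tolerances \<open>\<epsilon> / 8\<close> here and
    \<open>\<epsilon> / 16\<close> for \<open>k\<close> make the first two weighted errors at most
    \<open>\<epsilon> / 4\<close> each; the third is arranged likewise, which leaves a quarter to
    spare.\<close>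
  obtain m where m: "m > 0" "(LINT x|half_measure. (f x - max (- m) (min m (f x)))\<^sup>2) < \<epsilon> / 8"
    "sq_int (\<lambda>x. max (- m) (min m (f x)))" "sq_int (\<lambda>x. f x - max (- m) (min m (f x)))"
    using clamp_approx[OF f, of "\<epsilon> / 8"] \<open>\<epsilon> > 0\<close> by auto
  define g where "g = (\<lambda>x. max (- m) (min m (f x)))"
  obtain k where k: "continuous_on {0..pi} k" "(LINT x|half_measure. (g x - w x * k x)\<^sup>2) < \<epsilon> / 16"
  proof (rule weighted_continuous_approx[of g m w "\<epsilon> / 16"])
    show "g \<in> borel_measurable half_measure"
      using m(3) by (simp add: sq_int_def g_def)
    show "\<bar>g x\<bar> \<le> m" for x
      using m(1) by (auto simp: g_def)
  qed (use w \<open>\<epsilon> > 0\<close> in auto)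
  obtain B where B: "B > 0" "\<And>x. x \<in> {0..pi} \<Longrightarrow> \<bar>w x\<bar> \<le> B"
    using bounded_continuous_half[OF w(1)] by auto
  \<comment> \<open>A uniform error \<open>\<delta>\<close> times the bound \<open>B\<close> of the
    weight has square \<open>\<epsilon> / 64\<close>. Integration over an interval of length
    \<open>pi < 4\<close> makes this less than \<open>\<epsilon> / 16\<close>.\<close>
  define \<delta> where "\<delta> = sqrt (\<epsilon> / (64 * B\<^sup>2))"
  have \<delta>: "\<delta> > 0" "\<delta>\<^sup>2 * B\<^sup>2 = \<epsilon> / 64"
    using \<open>\<epsilon> > 0\<close> B(1) by (auto simp: \<delta>_def)
  have "continuous_on {-1..1} (\<lambda>u. k (arccos u))"
    by (rule continuous_on_compose2[OF k(1) continuous_on_arccos'])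
       (auto simp: arccos_lbound arccos_ubound)
  from Stone_Weierstrass_real_polynomial_function[OF compact_Icc this \<delta>(1)]
  obtain p where p: "real_polynomial_function p"
    "\<And>u. u \<in> {-1..1} \<Longrightarrow> \<bar>k (arccos u) - p u\<bar> < \<delta>" by blast
  have cp: "continuous_on S (\<lambda>x. p (cos x))" for S
    by (rule continuous_on_polynomial_cos[OF p(1)])
  have e1: "(LINT x|half_measure. (w x * (k x - p (cos x)))\<^sup>2) \<le> \<epsilon> / 64 * pi"
  proof -
    have "(LINT x|half_measure. (w x * (k x - p (cos x)))\<^sup>2) \<le> (LINT x|half_measure. \<epsilon> / 64)"
    proof (rule integral_mono)
      interpret finite_measure half_measure by (rule finite_half_measure)
      show "integrable half_measure (\<lambda>_. \<epsilon> / 64)" by simp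
      show "integrable half_measure (\<lambda>x. (w x * (k x - p (cos x)))\<^sup>2)"
        by (intro continuous_half(3) continuous_intros w k cp)
      fix x assume "x \<in> space half_measure"
      then have x: "x \<in> {0..pi}" by auto
      then have "\<bar>k x - p (cos x)\<bar> \<le> \<delta>"
        using p(2)[of "cos x"] by (simp add: arccos_cos)
      then have "\<bar>w x * (k x - p (cos x))\<bar> \<le> B * \<delta>"
        unfolding abs_mult using B(2)[OF x] B(1) by (intro mult_mono) auto
      from power_mono[OF this, of 2] show "(w x * (k x - p (cos x)))\<^sup>2 \<le> \<epsilon> / 64"
        using \<delta>(2) by (simp add: power_mult_distrib mult.commute)
    qed
    also have "\<dots> = \<epsilon> / 64 * pi" by (simp add: measure_restrict_space)
    finally show ?thesis .
  qed
  have s2: "sq_int (\<lambda>x. g x - w x * k x)"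
  proof -
    have "continuous_on {0..pi} (\<lambda>x. - (w x * k x))"
      by (intro continuous_intros w k)
    from sq_int_add(1)[OF m(3) continuous_half(2)[OF this]] show ?thesis
      by (simp add: g_def)
  qed
  have s3: "sq_int (\<lambda>x. w x * (k x - p (cos x)))"
    by (intro continuous_half(2) continuous_intros w k cp)
  have s1: "sq_int (\<lambda>x. f x - g x)"
    using m(4) by (simp add: g_def)
  have "(LINT x|half_measure. (f x - w x * p (cos x))\<^sup>2) = (LINT x|half_measure.
      ((f x - g x) + ((g x - w x * k x) + w x * (k x - p (cos x))))\<^sup>2)"
    by (intro Bochner_Integration.integral_cong refl arg_cong[where f = "\<lambda>y. y\<^sup>2"])
       (simp add: right_diff_distrib)
  also have "\<dots> \<le> 2 * (LINT x|half_measure. (f x - g x)\<^sup>2) + 2 * (LINT x|half_measure.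
      ((g x - w x * k x) + w x * (k x - p (cos x)))\<^sup>2)"
    using sq_int_add(2)[OF s1 sq_int_add(1)[OF s2 s3]] unfolding real_norm_def power2_abs .
  finally have "(LINT x|half_measure. (f x - w x * p (cos x))\<^sup>2) \<le>
      2 * (LINT x|half_measure. (f x - g x)\<^sup>2) + 2 * (LINT x|half_measure.
        ((g x - w x * k x) + w x * (k x - p (cos x)))\<^sup>2)" .
  moreover have "(LINT x|half_measure. ((g x - w x * k x) + w x * (k x - p (cos x)))\<^sup>2) \<le>
      2 * (LINT x|half_measure. (g x - w x * k x)\<^sup>2)
      + 2 * (LINT x|half_measure. (w x * (k x - p (cos x)))\<^sup>2)"
    using sq_int_add(2)[OF s2 s3] unfolding real_norm_def power2_abs .
  ultimately have "(LINT x|half_measure. (f x - w x * p (cos x))\<^sup>2) \<le>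
      2 * (LINT x|half_measure. (f x - g x)\<^sup>2) + 4 * (LINT x|half_measure. (g x - w x * k x)\<^sup>2)
      + 4 * (LINT x|half_measure. (w x * (k x - p (cos x)))\<^sup>2)"
    by linarith
  also have "\<dots> < 2 * (\<epsilon> / 8) + 4 * (\<epsilon> / 16) + 4 * (\<epsilon> / 64 * 4)"
  proof -
    have "\<epsilon> / 64 * pi < \<epsilon> / 64 * 4"
      using \<open>\<epsilon> > 0\<close> pi_less_4 by simp
    moreover have "(LINT x|half_measure. (f x - g x)\<^sup>2) < \<epsilon> / 8"
      using m(2) by (simp only: g_def)
    ultimately show ?thesis
      using k(2) e1 by linarith
  qed
  finally have "(LINT x|half_measure. (f x - w x * p (cos x))\<^sup>2) < \<epsilon>"
    using \<open>\<epsilon> > 0\<close> by simp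
  then show thesis
    using that p(1) by blast
qed

lemma complex_polynomial_cos_approx:
  fixes f :: "real \<Rightarrow> complex" and w :: "real \<Rightarrow> real"
  assumes f: "sq_int f"
    and w: "continuous_on {0..pi} w" "\<And>x. x \<in> {0<..<pi} \<Longrightarrow> w x \<noteq> 0" and "\<epsilon> > 0"
  obtains p q where "real_polynomial_function p" "real_polynomial_function q"
    "(LINT x|half_measure. (cmod (f x - of_real (w x) * Complex (p (cos x)) (q (cos x))))\<^sup>2) < \<epsilon>"
proof -
  have [measurable]: "f \<in> borel_measurable half_measure"
    and i: "integrable half_measure (\<lambda>x. (cmod (f x))\<^sup>2)"
    using f by (auto simp: sq_int_def)
  have "sq_int (\<lambda>x. Re (f x))" "sq_int (\<lambda>x. Im (f x))"
    unfolding sq_int_def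
    by (auto simp: cmod_power2 intro!: Bochner_Integration.integrable_bound[OF i])
  note ReIm = this
  obtain p where p: "real_polynomial_function p"
      "(LINT x|half_measure. (Re (f x) - w x * p (cos x))\<^sup>2) < \<epsilon> / 2"
    by (rule polynomial_cos_approx[OF ReIm(1) w, of "\<epsilon> / 2"]) (use \<open>\<epsilon> > 0\<close> in auto)
  obtain q where q: "real_polynomial_function q"
      "(LINT x|half_measure. (Im (f x) - w x * q (cos x))\<^sup>2) < \<epsilon> / 2"
    by (rule polynomial_cos_approx[OF ReIm(2) w, of "\<epsilon> / 2"]) (use \<open>\<epsilon> > 0\<close> in auto)
  have sub: "integrable half_measure (\<lambda>x. (g x - w x * p (cos x))\<^sup>2)"
    if "sq_int g" "real_polynomial_function p" for g p :: "real \<Rightarrow> real"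
  proof -
    have "continuous_on {0..pi} (\<lambda>x. - (w x * p (cos x)))"
      by (intro continuous_intros w continuous_on_polynomial_cos that)
    from sq_int_add(1)[OF that(1) continuous_half(2)[OF this]] show ?thesis
      by (simp add: sq_int_def)
  qed
  have "(cmod (f x - of_real (w x) * Complex (p (cos x)) (q (cos x))))\<^sup>2 =
      (Re (f x) - w x * p (cos x))\<^sup>2 + (Im (f x) - w x * q (cos x))\<^sup>2" for x
    by (simp add: cmod_power2)
  then have "(LINT x|half_measure. (cmod (f x - of_real (w x) * Complex (p (cos x)) (q (cos x))))\<^sup>2) < \<epsilon>"
    using p q sub[OF ReIm(1) p(1)] sub[OF ReIm(2) q(1)] by simp
  then show thesis
    using that p(1) q(1) by blast
qed

text \<open>Pythagoras: an element orthogonal to its approximants has norm at most the distance to them.\<close>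

lemma orthogonal_cos_powers_imp_AE_0:
  assumes g: "sq_int g"
    and orth: "\<And>n. (LINT x|half_measure. g x * of_real (cos x ^ n)) = (0::complex)"
  shows "AE x in half_measure. g x = 0"
proof -
  let ?N = "LINT x|half_measure. (cmod (g x))\<^sup>2"
  have pol: "(LINT x|half_measure. g x * of_real (p (cos x))) = 0"
    if rp: "real_polynomial_function p" for p
  proof -
    obtain a n where p: "p = (\<lambda>x. \<Sum>i\<le>n. a i * x ^ i)"
      using rp real_polynomial_function_iff_sum by blast
    have int: "integrable half_measure (\<lambda>x. g x * of_real (cos x ^ i))" for i
      by (intro sq_int_mult_continuous(2) g continuous_intros)
    have "(LINT x|half_measure. g x * of_real (p (cos x))) =
        (LINT x|half_measure. (\<Sum>i\<le>n. of_real (a i) * (g x * of_real (cos x ^ i))))"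
      by (simp add: p sum_distrib_left algebra_simps)
    also have "\<dots> = (\<Sum>i\<le>n. LINT x|half_measure. of_real (a i) * (g x * of_real (cos x ^ i)))"
      by (rule Bochner_Integration.integral_sum) (intro integrable_mult_right int)
    also have "\<dots> = 0"
      using orth int by simp
    finally show ?thesis .
  qed
  have "?N \<le> 0 + \<epsilon>" if "\<epsilon> > 0" for \<epsilon>
  proof -
    obtain p q where pq: "real_polynomial_function p" "real_polynomial_function q"
      "(LINT x|half_measure. (cmod (g x - of_real 1 * Complex (p (cos x)) (q (cos x))))\<^sup>2) < \<epsilon>"
      using complex_polynomial_cos_approx[OF g _ _ \<open>\<epsilon> > 0\<close>, of "\<lambda>_. 1"] by auto
    let ?h = "\<lambda>x. Complex (p (cos x)) (q (cos x))"
    have ct: "continuous_on {0..pi} (\<lambda>x. p (cos x))" "continuous_on {0..pi} (\<lambda>x. q (cos x))"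
      by (intro continuous_on_polynomial_cos pq)+
    then have ch: "continuous_on {0..pi} (\<lambda>x. (cmod (?h x))\<^sup>2)"
      unfolding cmod_power2 by (auto intro!: continuous_intros)
    have gp: "integrable half_measure (\<lambda>x. g x * of_real (p (cos x)))"
        "integrable half_measure (\<lambda>x. g x * of_real (q (cos x)))"
      using ct by (intro sq_int_mult_continuous(2) g continuous_intros; simp)+
    have gh: "g x * cnj (?h x) = g x * of_real (p (cos x)) - \<i> * (g x * of_real (q (cos x)))" for x
      by (simp add: complex_eq_iff)
    have igh: "integrable half_measure (\<lambda>x. g x * cnj (?h x))"
      and zgh: "(LINT x|half_measure. g x * cnj (?h x)) = 0"
      unfolding gh using gp pol[OF pq(1)] pol[OF pq(2)] by auto
    have igh': "integrable half_measure (\<lambda>x. 2 * Re (g x * cnj (?h x)))"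
      and zgh': "(LINT x|half_measure. 2 * Re (g x * cnj (?h x))) = 0"
      using integrable_mult_right[OF integrable_Re[OF igh], of 2] integral_Re[OF igh] zgh
        integral_mult_right_zero[of half_measure 2 "\<lambda>x. Re (g x * cnj (?h x))"]
      by (simp_all del: complex_cnj times_complex.sel)
    have ig: "integrable half_measure (\<lambda>x. (cmod (g x))\<^sup>2)"
      using g by (simp add: sq_int_def)
    have "(cmod (g x - ?h x))\<^sup>2 = (cmod (g x))\<^sup>2 + (cmod (?h x))\<^sup>2 - 2 * Re (g x * cnj (?h x))" for x
      unfolding cmod_power2 by (simp add: power2_eq_square algebra_simps)
    then have "(LINT x|half_measure. (cmod (g x - ?h x))\<^sup>2) =
        ?N + (LINT x|half_measure. (cmod (?h x))\<^sup>2)"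
      using ig continuous_half(3)[OF ch] igh' zgh' by simp
    moreover have "(LINT x|half_measure. (cmod (?h x))\<^sup>2) \<ge> 0"
      by simp
    ultimately show ?thesis
      using pq(3) unfolding of_real_1 mult_1_left by linarith
  qed
  then have "?N \<le> 0"
    by (rule field_le_epsilon)
  then have "?N = 0"
    by (intro antisym) auto
  then show ?thesis
    using g by (subst (asm) integral_nonneg_eq_0_iff_AE) (auto simp: sq_int_def)
qed

subsection \<open>Test forms on the half circle\<close>

abbreviation half_circle :: "(real \<times> real) set" where
  "half_circle \<equiv> {(cos \<phi>, sin \<phi>) |\<phi>. 0 < \<phi> \<and> \<phi> < pi}"

text \<open>Trades the angle for conditions on the coordinates, so that supports in the plane can be
  located by closed inequalities.\<close>

lemma half_circle_iff: "(x, y) \<in> half_circle \<longleftrightarrow> x\<^sup>2 + y\<^sup>2 = 1 \<and> y > 0"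
proof
  assume "x\<^sup>2 + y\<^sup>2 = 1 \<and> y > 0"
  then obtain t where t: "0 \<le> t" "t \<le> pi" "x = cos t" "y = sin t"
    using sincos_total_pi[of y x] by auto
  with \<open>x\<^sup>2 + y\<^sup>2 = 1 \<and> y > 0\<close> have "t \<noteq> 0" "t \<noteq> pi" by auto
  with t show "(x, y) \<in> half_circle" by auto
qed (auto simp: sin_gt_zero)

lemma circle_point_half: "circle_point \<phi> \<in> half_circle \<longleftrightarrow> sin \<phi> > 0"
  unfolding circle_point_def half_circle_iff by simp

lemma arc_measure_half: "arc_measure half_circle = half_measure"
proof -
  have "\<phi> > 0" "\<phi> < pi" if "- pi < \<phi>" "\<phi> \<le> pi" "sin \<phi> > 0" for \<phi>
  proof -
    show "\<phi> > 0"
      using sin_ge_zero[of "- \<phi>"] that by (force simp: not_less)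
    show "\<phi> < pi"
      using that by (cases "\<phi> = pi") auto
  qed
  then have "{\<phi> \<in> {- pi<..pi}. circle_point \<phi> \<in> half_circle} = {0<..<pi}"
    unfolding circle_point_half by (auto simp: sin_gt_zero)
  then show ?thesis
    unfolding arc_measure_def by simp
qed

lemma L2_forms_half: "q \<in> {0, 1} \<Longrightarrow> f \<in> L2_forms half_circle q \<longleftrightarrow> sq_int f"
  by (auto simp: L2_forms_def arc_measure_half sq_int_def)

lemma L2_forms_half_0: "(\<lambda>_. 0) \<in> L2_forms half_circle q"
  by (auto simp: L2_forms_def)

lemma L2_inner_half: "L2_inner half_circle f g = (LINT x|half_measure. f x * cnj (g x))"
  unfolding L2_inner_def arc_measure_half ..

lemma smooth_circle_formsI:
  "smooth_real f \<Longrightarrow> (\<And>x. f (x + 2 * pi) = f x) \<Longrightarrow> q \<in> {0, 1} \<Longrightarrow>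
    (\<lambda>x. of_real (f x)) \<in> smooth_circle_forms q"
  by (auto simp: smooth_circle_forms_def smooth_real_imp_smooth_fun)

lemma form_support_subset:
  "closed S \<Longrightarrow> (\<And>x. \<Psi> x \<noteq> 0 \<Longrightarrow> circle_point x \<in> S) \<Longrightarrow> form_support \<Psi> \<subseteq> S"
  unfolding form_support_def by (rule closure_minimal) auto

text \<open>The uniform bound \<open>s\<close> matters: \<open>sin x \<ge> s\<close> is a closed
  condition, which survives the closure in \<open>form_support\<close>, whereas
  \<open>sin x > 0\<close> would not.\<close>

lemma compactly_supported_formsI:
  assumes "smooth_real f" "\<And>x. f (x + 2 * pi) = f x" "q \<in> {0, 1}"
    and s: "s > 0" "\<And>x. f x \<noteq> 0 \<Longrightarrow> sin x \<ge> s"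
  shows "(\<lambda>x. of_real (f x)) \<in> compactly_supported_forms half_circle q"
proof -
  have "form_support (\<lambda>x. of_real (f x)) \<subseteq> {p. (fst p)\<^sup>2 + (snd p)\<^sup>2 = 1 \<and> s \<le> snd p}"
    using s(2)
    by (intro form_support_subset closed_Collect_conj closed_Collect_eq closed_Collect_le continuous_intros)
       (auto simp: circle_point_def)
  also have "\<dots> \<subseteq> half_circle"
  proof
    fix p assume "p \<in> {p. (fst p)\<^sup>2 + (snd p)\<^sup>2 = 1 \<and> s \<le> snd p}"
    then show "p \<in> half_circle"
      using s(1) half_circle_iff[of "fst p" "snd p"] by simp
  qed
  finally show ?thesis
    using smooth_circle_formsI[OF assms(1-3)] by (simp add: compactly_supported_forms_def)
qed

text \<open>The sign \<open>\<sigma>\<close> handles both endpoints at once. The support keeps a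
  distance of at least \<open>s\<close> from the point \<open>(- \<sigma>, 0)\<close> already in the
  first coordinate.\<close>

lemma smooth_forms_offI:
  assumes "smooth_real f" "\<And>x. f (x + 2 * pi) = f x" "q \<in> {0, 1}"
    and \<sigma>: "\<sigma> \<in> {1, -1}" and s: "s > 0" "\<And>x. f x \<noteq> 0 \<Longrightarrow> \<sigma> * cos x \<ge> s - 1"
  shows "(\<lambda>x. of_real (f x)) \<in> smooth_forms_off S q {(- \<sigma>, 0)}"
proof -
  have "form_support (\<lambda>x. of_real (f x)) \<subseteq> {p. s - 1 \<le> \<sigma> * fst p}"
    using s(2) by (intro form_support_subset closed_Collect_le continuous_intros)
       (auto simp: circle_point_def)
  moreover have "s \<le> dist p (- \<sigma>, 0)" if "s - 1 \<le> \<sigma> * fst p" for p :: "real \<times> real"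
  proof -
    have "s \<le> \<bar>fst p - (- \<sigma>)\<bar>"
      using that \<sigma> by auto
    also have "\<dots> \<le> dist p (- \<sigma>, 0)"
      using dist_fst_le[of p "(- \<sigma>, 0)"] by (simp add: dist_real_def)
    finally show ?thesis .
  qed
  ultimately show ?thesis
    unfolding smooth_forms_off_def using smooth_circle_formsI[OF assms(1-3)] s(1)
    by (auto intro!: bexI[of _ "\<lambda>x. of_real (f x)"] exI[of _ s])
qed

section \<open>Forms annihilated by all derivatives of test forms\<close>

lemma AE_0_of_cutoffs:
  assumes c: "\<And>n. AE x in half_measure. f x * c (inverse (real (Suc n))) x = (0::complex)"
    and pos: "\<And>x. x \<in> {0<..<pi} \<Longrightarrow> h x > 0"
    and nz: "\<And>x s. x \<in> {0<..<pi} \<Longrightarrow> s < h x \<Longrightarrow> c s x \<noteq> 0"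
  shows "AE x in half_measure. f x = 0"
proof -
  have "AE x in half_measure. \<forall>n. f x * c (inverse (real (Suc n))) x = 0"
    by (subst AE_all_countable) (intro allI c)
  then show ?thesis
    using AE_space
  proof eventually_elim
    case (elim x)
    then have x: "x \<in> {0<..<pi}" by simp
    \<comment> \<open>The thresholds tend to 0, so at every point some cutoff of the sequence is
      nonzero; countably many exceptional null sets do no harm.\<close>
    obtain n where "inverse (real (Suc n)) < h x"
      using reals_Archimedean[OF pos[OF x]] by blast
    with nz[OF x] elim(1) show ?case by (metis mult_eq_0_iff)
  qed
qed

text \<open>A cutoff in \<open>sin x\<close> times powers of \<open>cos x\<close> is a smooth
  periodic test form. Read with the cutoff moved over to \<open>F\<close>, the hypothesis says that
  the cut-off \<open>F\<close> is orthogonal to all powers of the cosine.\<close>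

lemma compact_tests_imp_AE_0:
  assumes F: "sq_int F" and q: "q \<in> {0, 1}"
    and orth: "\<And>\<Phi>. \<Phi> \<in> compactly_supported_forms half_circle q \<Longrightarrow> L2_inner half_circle F \<Phi> = 0"
  shows "AE x in half_measure. F x = 0"
proof (rule AE_0_of_cutoffs[where h = sin and c = "\<lambda>s x. of_real (bump 0 (sin x - s))"])
  fix n :: nat
  define s where "s = inverse (real (Suc n))"
  have s: "s > 0" by (simp add: s_def)
  have "AE x in half_measure. F x * of_real (bump 0 (sin x - s)) = 0"
  proof (rule orthogonal_cos_powers_imp_AE_0)
    show "sq_int (\<lambda>x. F x * of_real (bump 0 (sin x - s)))"
      by (intro sq_int_mult_continuous F continuous_intros)
    fix k
    have "smooth_real (\<lambda>x. bump 0 (sin x + (- s)) * cos x ^ k)"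
      by (intro smooth_real.mult smooth_real_power smooth_real.cos
          smooth_real.comp[OF smooth_real.bump] smooth_real.add smooth_real.sin smooth_real.const)
    then have "(\<lambda>x. of_real (bump 0 (sin x + (- s)) * cos x ^ k)) \<in> compactly_supported_forms half_circle q"
      by (rule compactly_supported_formsI[OF _ _ q s]) (auto intro: ccontr simp: bump_eq_0)
    from orth[OF this] show "(LINT x|half_measure. F x * of_real (bump 0 (sin x - s)) * of_real (cos x ^ k)) = 0"
      by (simp add: L2_inner_half mult.assoc)
  qed
  then show "AE x in half_measure. F x * of_real (bump 0 (sin x - inverse (real (Suc n)))) = 0"
    by (simp add: s_def)
qed (auto simp: sin_gt_zero bump_0_pos less_imp_neq[symmetric])

text \<open>The test forms are \<open>g (\<sigma> cos \<phi>)\<close> with \<open>g\<close> an antiderivative, vanishing near \<open>-1\<close>, of a cutoff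
  times a monomial; their derivatives are a cutoff times \<open>sin \<phi> cos\<^sup>k \<phi>\<close>.\<close>

lemma boundary_tests_imp_AE_0:
  assumes E: "sq_int E" and q: "q \<in> {0, 1}" and \<sigma>: "\<sigma> \<in> {1, -1}"
    and orth: "\<And>\<Phi>. \<Phi> \<in> smooth_forms_off half_circle q {(- \<sigma>, 0)} \<Longrightarrow>
      L2_inner half_circle E (\<lambda>x. vector_derivative \<Phi> (at x)) = 0"
  shows "AE x in half_measure. E x = 0"
proof (rule AE_0_of_cutoffs[where h = "\<lambda>x. \<sigma> * cos x + 1"
      and c = "\<lambda>s x. of_real (sin x * bump 0 (\<sigma> * cos x + 1 - s))"])
  fix n :: nat
  define s where "s = inverse (real (Suc n))"
  have s: "s > 0" by (simp add: s_def)
  have "AE x in half_measure. E x * of_real (sin x * bump 0 (\<sigma> * cos x + 1 - s)) = 0"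
  proof (rule orthogonal_cos_powers_imp_AE_0)
    show "sq_int (\<lambda>x. E x * of_real (sin x * bump 0 (\<sigma> * cos x + 1 - s)))"
      by (intro sq_int_mult_continuous E continuous_intros)
    fix k
    \<comment> \<open>The inner \<open>\<sigma>\<close> cancels the one in the argument
      \<open>\<sigma> * cos x\<close>, so the power becomes \<open>cos x ^ k\<close> for either
      sign; the cutoff is active for \<open>u > s - 1\<close>, that is, away from the point
      \<open>u = -1\<close>.\<close>
    let ?g' = "\<lambda>u. bump 0 (u + (1 - s)) * (\<sigma> * u) ^ k"
    have "smooth_real ?g'"
      by (intro smooth_real.mult smooth_real_power smooth_real_id
          smooth_real.comp[OF smooth_real.bump] smooth_real.add smooth_real.const)
    then obtain g where g: "smooth_real g" "\<And>x. (g has_real_derivative ?g' x) (at x)"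
      "\<And>x. x \<le> s - 1 \<Longrightarrow> g x = 0"
      by (rule smooth_real_antiderivative[of _ "s - 1"]) (auto simp: bump_eq_0)
    let ?\<Phi> = "\<lambda>x. complex_of_real (g (\<sigma> * cos x))"
    have "smooth_real (\<lambda>x. g (\<sigma> * cos x))"
      by (intro smooth_real.comp[OF g(1)] smooth_real.mult smooth_real.const smooth_real.cos)
    then have test: "?\<Phi> \<in> smooth_forms_off half_circle q {(- \<sigma>, 0)}"
      by (rule smooth_forms_offI[OF _ _ q \<sigma> s]) (auto intro: ccontr simp: g(3))
    have "((\<lambda>x. g (\<sigma> * cos x)) has_real_derivative ?g' (\<sigma> * cos x) * (- \<sigma> * sin x)) (at x)" for x
      by (rule DERIV_chain2[OF g(2)]) (auto intro!: derivative_eq_intros)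
    then have "(?\<Phi> has_vector_derivative of_real (?g' (\<sigma> * cos x) * (- \<sigma> * sin x))) (at x)" for x
      by (intro has_vector_derivative_of_real)
         (simp add: has_real_derivative_iff_has_vector_derivative)
    then have D: "vector_derivative ?\<Phi> (at x) = of_real (?g' (\<sigma> * cos x) * (- \<sigma> * sin x))" for x
      by (rule vector_derivative_at)
    have \<sigma>\<sigma>: "\<sigma> * (\<sigma> * y) = y" for y
      using \<sigma> by auto
    have "E x * cnj (vector_derivative ?\<Phi> (at x)) = of_real (- \<sigma>) *
        (E x * of_real (sin x * bump 0 (\<sigma> * cos x + 1 - s)) * of_real (cos x ^ k))" for x
      unfolding D \<sigma>\<sigma> by (simp add: algebra_simps)
    with orth[OF test] show "(LINT x|half_measure. E x *
        of_real (sin x * bump 0 (\<sigma> * cos x + 1 - s)) * of_real (cos x ^ k)) = 0"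
      using \<sigma> unfolding L2_inner_half by (simp del: of_real_mult of_real_power of_real_minus) auto
  qed
  then show "AE x in half_measure. E x *
      of_real (sin x * bump 0 (\<sigma> * cos x + 1 - inverse (real (Suc n)))) = 0"
    by (simp add: s_def)
next
  fix x :: real assume x: "x \<in> {0<..<pi}"
  have "cos x < cos 0" "cos pi < cos x"
    using x by (intro cos_monotone_0_pi; simp)+
  then show "\<sigma> * cos x + 1 > 0"
    using \<sigma> by auto
  show "s < \<sigma> * cos x + 1 \<Longrightarrow> complex_of_real (sin x * bump 0 (\<sigma> * cos x + 1 - s)) \<noteq> 0" for s
    using sin_gt_zero[of x] x bump_0_pos[of "\<sigma> * cos x + 1 - s"] by simp
qed

text \<open>Both \<open>F\<close> and 0 are weak derivatives of \<open>E\<close>, so compactly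
  supported tests force \<open>F\<close> to be null. The boundary condition, which is known only for
  \<open>F\<close>, then becomes orthogonality to derivatives of tests that vanish near a single
  endpoint.\<close>

lemma weak_derivative_0_imp_AE_0:
  assumes "sq_int E" "sq_int F" and q: "q \<in> {0, 1}" and \<sigma>: "\<sigma> \<in> {1, -1}"
    and F: "\<And>\<Phi>. \<Phi> \<in> compactly_supported_forms half_circle q \<Longrightarrow>
      L2_inner half_circle E (\<lambda>x. vector_derivative \<Phi> (at x)) = - L2_inner half_circle F \<Phi>"
    and 0: "\<And>\<Phi>. \<Phi> \<in> compactly_supported_forms half_circle q \<Longrightarrow>
      L2_inner half_circle E (\<lambda>x. vector_derivative \<Phi> (at x)) = - L2_inner half_circle (\<lambda>_. 0) \<Phi>"
    and bd: "\<And>\<Phi>. \<Phi> \<in> smooth_forms_off half_circle q {(- \<sigma>, 0)} \<Longrightarrow>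
      L2_inner half_circle E (\<lambda>x. vector_derivative \<Phi> (at x)) = - L2_inner half_circle F \<Phi>"
  shows "AE x in half_measure. E x = 0"
proof -
  have "AE x in half_measure. F x = 0"
    by (rule compact_tests_imp_AE_0[OF assms(2) q]) (use F 0 in \<open>auto simp: L2_inner_half\<close>)
  then have "L2_inner half_circle F \<Phi> = 0" for \<Phi>
    unfolding L2_inner_half by (intro integral_eq_zero_AE) auto
  with bd show ?thesis
    by (intro boundary_tests_imp_AE_0[OF assms(1) q \<sigma>]) simp
qed

lemma R0_half_AE_0:
  assumes "E \<in> R0_space half_circle {(1, 0)} 0"
  shows "AE x in half_measure. E x = 0"
proof -
  obtain F where F: "has_rot half_circle 0 E F" "has_rot half_circle 0 E (\<lambda>_. 0)"
    "\<And>\<Phi>. \<Phi> \<in> smooth_forms_off half_circle 1 {(1, 0)} \<Longrightarrow>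
      L2_inner half_circle E (smooth_div 1 \<Phi>) = - L2_inner half_circle F \<Phi>"
    using assms unfolding R0_space_def R_space_def by auto
  \<comment> \<open>For \<open>R\<close> in degree 0 the tests have degree 1 and stay away from
    \<open>(1, 0)\<close>, which is the case \<open>\<sigma> = -1\<close>; for \<open>D\<close> in
    degree 1 the sign is reversed.\<close>
  show ?thesis
    by (rule weak_derivative_0_imp_AE_0[of E F 1 "- 1"])
       (use F in \<open>simp_all add: has_rot_def L2_forms_half smooth_div_def[abs_def]\<close>)
qed

lemma D0_half_AE_0:
  assumes "E \<in> D0_space half_circle {(-1, 0)} 1"
  shows "AE x in half_measure. E x = 0"
proof -
  obtain F where F: "has_div half_circle 1 E F" "has_div half_circle 1 E (\<lambda>_. 0)"
    "\<And>\<Phi>. \<Phi> \<in> smooth_forms_off half_circle 0 {(-1, 0)} \<Longrightarrow>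
      L2_inner half_circle E (smooth_rot 0 \<Phi>) = - L2_inner half_circle F \<Phi>"
    using assms unfolding D0_space_def D_space_def by auto
  show ?thesis
    by (rule weak_derivative_0_imp_AE_0[of E F 0 1])
       (use F in \<open>simp_all add: has_div_def L2_forms_half smooth_rot_def[abs_def]\<close>)
qed

section \<open>Classical derivatives as weak derivatives\<close>

lemma smooth_fun_has_vector_derivative:
  assumes "smooth_fun \<Psi>"
  shows "(\<Psi> has_vector_derivative vector_derivative \<Psi> (at x)) (at x)"
    and "continuous_on S (\<lambda>x. vector_derivative \<Psi> (at x))"
    and "continuous_on S \<Psi>"
proof -
  obtain D where D: "D 0 = \<Psi>" "\<And>k x. (D k has_vector_derivative D (Suc k) x) (at x)"
    using assms unfolding smooth_fun_def by blast
  have eq: "vector_derivative \<Psi> (at x) = D 1 x" for x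
    using D(2)[of 0 x] D(1) by (simp add: vector_derivative_at)
  show "(\<Psi> has_vector_derivative vector_derivative \<Psi> (at x)) (at x)"
    using D(2)[of 0 x] D(1) by (simp add: eq)
  have "continuous_on S (D k)" for k
    by (intro continuous_at_imp_continuous_on ballI has_vector_derivative_continuous[OF D(2)])
  from this[of 0] this[of 1] show "continuous_on S \<Psi>"
      "continuous_on S (\<lambda>x. vector_derivative \<Psi> (at x))"
    by (simp_all add: eq D(1))
qed

text \<open>At each endpoint the boundary term dies through one of its factors. The disjunctions
  cover compactly supported tests, which vanish at both ends, as well as tests that vanish at one
  end and leave the other to \<open>u\<close>.\<close>

lemma L2_inner_by_parts:
  assumes u: "\<And>x. (u has_vector_derivative u' x) (at x)" "continuous_on {0..pi} u'"
    and \<Psi>: "smooth_fun \<Psi>" and bd: "u 0 = 0 \<or> \<Psi> 0 = 0" "u pi = 0 \<or> \<Psi> pi = 0"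
  shows "L2_inner half_circle u (\<lambda>x. vector_derivative \<Psi> (at x)) = - L2_inner half_circle u' \<Psi>"
proof -
  note D = smooth_fun_has_vector_derivative[OF \<Psi>]
  have cu: "continuous_on {0..pi} u"
    by (intro continuous_at_imp_continuous_on ballI has_vector_derivative_continuous[OF u(1)])
  have d: "((\<lambda>x. u x * cnj (\<Psi> x)) has_vector_derivative
      u x * cnj (vector_derivative \<Psi> (at x)) + u' x * cnj (\<Psi> x)) (at x)" for x
    by (intro has_vector_derivative_mult u(1) has_vector_derivative_cnj D(1))
  have "(LINT x|half_measure. u x * cnj (vector_derivative \<Psi> (at x)) + u' x * cnj (\<Psi> x))
      = u pi * cnj (\<Psi> pi) - u 0 * cnj (\<Psi> 0)"
    by (intro integral_half_FTC[OF d] continuous_intros cu u(2) D)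
  also have "\<dots> = 0"
    using bd by auto
  finally show ?thesis
    unfolding L2_inner_half
    by (subst (asm) Bochner_Integration.integral_add)
       (auto intro!: continuous_half(3) continuous_intros cu u(2) D simp: eq_neg_iff_add_eq_0)
qed

lemma form_support_I: "\<Psi> x \<noteq> 0 \<Longrightarrow> circle_point x \<in> form_support \<Psi>"
  unfolding form_support_def by (rule closure_subset[THEN subsetD]) auto

lemma weak_derivative_compact:
  assumes u: "\<And>x. (u has_vector_derivative u' x) (at x)" "continuous_on {0..pi} u'"
    and \<Psi>: "\<Psi> \<in> compactly_supported_forms half_circle q"
  shows "L2_inner half_circle u (\<lambda>x. vector_derivative \<Psi> (at x)) = - L2_inner half_circle u' \<Psi>"
proof -
  have "form_support \<Psi> \<subseteq> half_circle"
    using \<Psi> by (simp add: compactly_supported_forms_def)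
  then have z: "sin x \<le> 0 \<Longrightarrow> \<Psi> x = 0" for x
    using form_support_I[of \<Psi> x] circle_point_half[of x] not_le by blast
  show ?thesis
    by (rule L2_inner_by_parts[OF u]) (use \<Psi> z[of 0] z[of pi] in
        \<open>auto simp: compactly_supported_forms_def smooth_circle_forms_def\<close>)
qed

lemma weak_derivative_off:
  assumes u: "\<And>x. (u has_vector_derivative u' x) (at x)" "continuous_on {0..pi} u'"
    and \<Phi>: "\<Phi> \<in> smooth_forms_off half_circle q {circle_point a}"
    and ab: "{a, b} = {0, pi}" "u b = 0"
  shows "L2_inner half_circle u (\<lambda>x. vector_derivative \<Phi> (at x)) = - L2_inner half_circle u' \<Phi>"
proof -
  obtain \<Psi> \<delta> where \<Psi>: "smooth_fun \<Psi>" "\<delta> > 0"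
    "\<And>x. x \<in> form_support \<Psi> \<Longrightarrow> \<delta> \<le> dist x (circle_point a)"
    "\<And>x. sin x > 0 \<Longrightarrow> \<Phi> x = \<Psi> x"
    using \<Phi> unfolding smooth_forms_off_def smooth_circle_forms_def circle_point_half by blast
  have "\<Psi> a = 0"
    using form_support_I[of \<Psi> a] \<Psi>(2) \<Psi>(3)[of "circle_point a"] by auto
  \<comment> \<open>\<open>\<Phi>\<close> agrees with the smooth \<open>\<Psi>\<close> only over the
    half circle. This is open in the angle, so the derivatives agree there too, and integration by
    parts can use the endpoint values of \<open>\<Psi>\<close>.\<close>
  have eq: "vector_derivative \<Phi> (at x) = vector_derivative \<Psi> (at x)" if "x \<in> {0<..<pi}" for x
  proof (rule vector_derivative_at)
    show "(\<Phi> has_vector_derivative vector_derivative \<Psi> (at x)) (at x)"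
      by (rule has_vector_derivative_transform_within_open
          [OF smooth_fun_has_vector_derivative(1)[OF \<Psi>(1)] open_greaterThanLessThan that])
         (simp add: \<Psi>(4) sin_gt_zero)
  qed
  have "L2_inner half_circle u (\<lambda>x. vector_derivative \<Phi> (at x))
      = L2_inner half_circle u (\<lambda>x. vector_derivative \<Psi> (at x))"
    unfolding L2_inner_half by (rule Bochner_Integration.integral_cong) (auto simp: eq)
  also have "\<dots> = - L2_inner half_circle u' \<Psi>"
    by (rule L2_inner_by_parts[OF u \<Psi>(1)]) (use ab \<open>\<Psi> a = 0\<close> in \<open>auto simp: doubleton_eq_iff\<close>)
  also have "L2_inner half_circle u' \<Psi> = L2_inner half_circle u' \<Phi>"
    unfolding L2_inner_half by (rule Bochner_Integration.integral_cong) (auto simp: \<Psi>(4) sin_gt_zero)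
  finally show ?thesis .
qed

text \<open>Tests for \<open>R\<close> vanish near the angle 0 but are free at \<open>pi\<close>, so
  the Dirichlet condition on \<open>u\<close> sits at \<open>pi\<close>, the point
  \<open>(-1, 0)\<close>. For \<open>D\<close> the roles of the endpoints are exchanged.\<close>

lemma has_rot_half:
  assumes u: "\<And>x. (u has_vector_derivative u' x) (at x)" "continuous_on {0..pi} u'"
  shows "has_rot half_circle 0 u u'"
    and "u pi = 0 \<Longrightarrow> u \<in> R_space half_circle {(1, 0)} 0"
proof -
  have cu: "continuous_on {0..pi} u"
    by (intro continuous_at_imp_continuous_on ballI has_vector_derivative_continuous[OF u(1)])
  show *: "has_rot half_circle 0 u u'"
    using weak_derivative_compact[OF u, of _ 1] continuous_half(2)[OF cu] continuous_half(2)[OF u(2)]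
    by (simp add: has_rot_def L2_forms_half smooth_div_def[abs_def])
  show "u \<in> R_space half_circle {(1, 0)} 0" if "u pi = 0"
    using weak_derivative_off[OF u, of _ 1 0 pi] * that
    by (auto simp: R_space_def circle_point_def smooth_div_def[abs_def])
qed

lemma has_div_half:
  assumes u: "\<And>x. (u has_vector_derivative u' x) (at x)" "continuous_on {0..pi} u'"
  shows "has_div half_circle 1 u u'"
    and "u 0 = 0 \<Longrightarrow> u \<in> D_space half_circle {(-1, 0)} 1"
proof -
  have cu: "continuous_on {0..pi} u"
    by (intro continuous_at_imp_continuous_on ballI has_vector_derivative_continuous[OF u(1)])
  show *: "has_div half_circle 1 u u'"
    using weak_derivative_compact[OF u, of _ 0] continuous_half(2)[OF cu] continuous_half(2)[OF u(2)]
    by (simp add: has_div_def L2_forms_half smooth_rot_def[abs_def])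
  show "u \<in> D_space half_circle {(-1, 0)} 1" if "u 0 = 0"
    using weak_derivative_off[OF u, of _ 0 pi 0] * that
    by (auto simp: D_space_def circle_point_def smooth_rot_def[abs_def])
qed

section \<open>Divergence-free and harmonic forms in degree 0\<close>

lemma D0_half_0: "D0_space half_circle \<Gamma> 0 = {f. sq_int f}"
proof -
  have "has_div half_circle 0 f (\<lambda>_. 0)" if "sq_int f" for f
    using that L2_forms_half_0
    by (auto simp: has_div_def L2_forms_half smooth_rot_def[abs_def] L2_inner_half)
  then have "f \<in> D0_space half_circle \<Gamma> 0" if "sq_int f" for f
    using that unfolding D0_space_def D_space_def
    by (auto simp: L2_inner_half smooth_rot_def[abs_def] intro!: exI[of _ "\<lambda>_. 0"])
  moreover have "sq_int f" if "f \<in> D0_space half_circle \<Gamma> 0" for f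
    using that by (simp add: D0_space_def has_div_def L2_forms_half)
  ultimately show ?thesis by blast
qed

lemma harmonic_dim_half_0: "harmonic_dim half_circle \<Gamma>1 {(1, 0)} 0 = 0"
proof -
  have "N = 0" if B: "\<forall>k<N. B k \<in> R0_space half_circle {(1, 0)} 0 \<inter> D0_space half_circle \<Gamma>1 0"
    and ind: "\<forall>a :: nat \<Rightarrow> complex. (AE \<phi> in half_measure. (\<Sum>k<N. a k * B k \<phi>) = 0)
        \<longrightarrow> (\<forall>k<N. a k = 0)" for N B
  proof (rule ccontr)
    assume "N \<noteq> 0"
    then have "AE x in half_measure. B 0 x = 0"
      using B R0_half_AE_0 by blast
    \<comment> \<open>As \<open>B 0\<close> is null, the first unit vector of coefficients is a
      nontrivial linear relation.\<close>
    then have "AE x in half_measure. (\<Sum>k<N. (if k = 0 then 1 else 0) * B k x) = 0"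
      by eventually_elim (auto intro!: sum.neutral)
    with ind[THEN spec, of "\<lambda>k. if k = 0 then 1 else 0"] \<open>N \<noteq> 0\<close> show False by auto
  qed
  then show ?thesis
    unfolding harmonic_dim_def L2_dim_def arc_measure_half
    by (intro antisym[OF Sup_least zero_le]) (auto simp: zero_enat_def)
qed

subsection \<open>Trigonometric systems\<close>

text \<open>The families carry an index 0, so that a three-term recursion makes sense at
  \<open>n = 1\<close>, but only members with \<open>n \<ge> 1\<close> count for the span.
  Coefficients are real and the identity holds at every point.\<close>

definition in_span :: "(nat \<Rightarrow> real \<Rightarrow> real) \<Rightarrow> (real \<Rightarrow> real) \<Rightarrow> bool" where
  "in_span e g \<longleftrightarrow> (\<exists>T c. finite T \<and> T \<subseteq> {1..} \<and> (\<forall>x. g x = (\<Sum>n\<in>T. c n * e n x)))"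

lemma in_span_basis: "n \<ge> 1 \<Longrightarrow> in_span e (e n)"
  unfolding in_span_def by (intro exI[of _ "{n}"] exI[of _ "\<lambda>_. 1"]) auto

lemma in_span_scale: assumes "in_span e g" shows "in_span e (\<lambda>x. a * g x)"
proof -
  obtain T c where "finite T" "T \<subseteq> {1..}" "\<And>x. g x = (\<Sum>n\<in>T. c n * e n x)"
    using assms unfolding in_span_def by blast
  then show ?thesis
    unfolding in_span_def
    by (intro exI[of _ T] exI[of _ "\<lambda>n. a * c n"]) (auto simp: sum_distrib_left mult.assoc)
qed

lemma in_span_add:
  assumes "in_span e g" "in_span e h" shows "in_span e (\<lambda>x. g x + h x)"
proof -
  obtain T c where T: "finite T" "T \<subseteq> {1..}" "\<And>x. g x = (\<Sum>n\<in>T. c n * e n x)"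
    using assms unfolding in_span_def by blast
  obtain T' c' where T': "finite T'" "T' \<subseteq> {1..}" "\<And>x. h x = (\<Sum>n\<in>T'. c' n * e n x)"
    using assms unfolding in_span_def by blast
  have "g x = (\<Sum>n\<in>T \<union> T'. (if n \<in> T then c n else 0) * e n x)" for x
    unfolding T(3) using T(1) T'(1) by (intro sum.mono_neutral_cong_left) auto
  moreover have "h x = (\<Sum>n\<in>T \<union> T'. (if n \<in> T' then c' n else 0) * e n x)" for x
    unfolding T'(3) using T(1) T'(1) by (intro sum.mono_neutral_cong_left) auto
  ultimately have "g x + h x = (\<Sum>n\<in>T \<union> T'.
      ((if n \<in> T then c n else 0) + (if n \<in> T' then c' n else 0)) * e n x)" for x
    by (simp add: distrib_right sum.distrib)
  then show ?thesis
    unfolding in_span_def using T(1,2) T'(1,2)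
    by (intro exI[of _ "T \<union> T'"] exI[of _ "\<lambda>n. (if n \<in> T then c n else 0) + (if n \<in> T' then c' n else 0)"]) auto
qed

lemma in_span_sum:
  assumes "finite T" "T \<noteq> {}" "\<And>n. n \<in> T \<Longrightarrow> in_span e (g n)"
  shows "in_span e (\<lambda>x. \<Sum>n\<in>T. g n x)"
  using assms by (induction T rule: finite_ne_induct) (auto intro: in_span_add)

text \<open>Once multiplication by the cosine maps each basis function into the span, the whole span
  is stable under it; iteration from \<open>e 1\<close> reaches every polynomial factor.\<close>

lemma in_span_polynomial_cos:
  assumes cos: "\<And>n. n \<ge> 1 \<Longrightarrow> in_span e (\<lambda>x. e n x * cos x)"
    and p: "real_polynomial_function p"
  shows "in_span e (\<lambda>x. e 1 x * p (cos x))"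
proof -
  have zero: "in_span e (\<lambda>_. 0)"
    unfolding in_span_def by (intro exI[of _ "{}"]) auto
  have mult: "in_span e (\<lambda>x. g x * cos x)" if g: "in_span e g" for g
  proof -
    obtain T c where T: "finite T" "T \<subseteq> {1..}" and g: "g = (\<lambda>x. \<Sum>n\<in>T. c n * e n x)"
      using g unfolding in_span_def by blast
    have "in_span e (\<lambda>x. \<Sum>n\<in>T. c n * (e n x * cos x))"
      by (cases "T = {}") (use T zero in \<open>auto intro!: in_span_sum in_span_scale cos\<close>)
    then show ?thesis
      by (simp add: g sum_distrib_right mult.assoc)
  qed
  have pow: "in_span e (\<lambda>x. e 1 x * cos x ^ i)" for i
  proof (induction i)
    case (Suc i)
    from mult[OF this] show ?case by (simp add: mult_ac)
  qed (simp add: in_span_basis)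
  obtain a n where "p = (\<lambda>x. \<Sum>i\<le>n. a i * x ^ i)"
    using p real_polynomial_function_iff_sum by blast
  moreover have "in_span e (\<lambda>x. \<Sum>i\<le>n. a i * (e 1 x * cos x ^ i))"
    by (intro in_span_sum in_span_scale pow) auto
  ultimately show ?thesis
    by (simp add: sum_distrib_left mult_ac)
qed

lemma span_dense:
  assumes cos: "\<And>n. n \<ge> 1 \<Longrightarrow> in_span e (\<lambda>x. e n x * cos x)"
    and e1: "continuous_on {0..pi} (e 1)" "\<And>x. x \<in> {0<..<pi} \<Longrightarrow> e 1 x \<noteq> 0"
    and f: "sq_int f" and "\<epsilon> > 0" and \<kappa>: "\<kappa> \<noteq> 0"
  shows "\<exists>T c. finite T \<and> T \<subseteq> {1..} \<and>
    L2_norm half_circle (\<lambda>x. f x - (\<Sum>n\<in>T. c n * (\<kappa> * of_real (e n x)))) < \<epsilon>"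
proof -
  obtain p q where p: "real_polynomial_function p" and q: "real_polynomial_function q"
    and pq: "(LINT x|half_measure. (cmod (f x - of_real (e 1 x) * Complex (p (cos x)) (q (cos x))))\<^sup>2) < \<epsilon>\<^sup>2"
    by (rule complex_polynomial_cos_approx[OF f e1, of "\<epsilon>\<^sup>2"]) (use \<open>\<epsilon> > 0\<close> in auto)
  obtain S a where S: "finite S" "S \<subseteq> {1..}" "\<And>x. e 1 x * p (cos x) = (\<Sum>n\<in>S. a n * e n x)"
    using in_span_polynomial_cos[OF cos p] unfolding in_span_def by blast
  obtain T b where T: "finite T" "T \<subseteq> {1..}" "\<And>x. e 1 x * q (cos x) = (\<Sum>n\<in>T. b n * e n x)"
    using in_span_polynomial_cos[OF cos q] unfolding in_span_def by blast
  \<comment> \<open>The real systems for \<open>p\<close> and \<open>q\<close> are padded by zeros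
    to a common index set and become real and imaginary parts; division by \<open>\<kappa>\<close>
    undoes the normalization of the basis.\<close>
  define c where "c n = Complex (if n \<in> S then a n else 0) (if n \<in> T then b n else 0) / \<kappa>" for n
  have c: "c n * (\<kappa> * of_real (e n x)) =
      Complex (if n \<in> S then a n * e n x else 0) (if n \<in> T then b n * e n x else 0)" for n x
  proof -
    have "c n * \<kappa> = Complex (if n \<in> S then a n else 0) (if n \<in> T then b n else 0)"
      using \<kappa> by (simp add: c_def)
    then show ?thesis
      unfolding mult.assoc[symmetric] by (simp add: complex_eq_iff)
  qed
  have "of_real (e 1 x) * Complex (p (cos x)) (q (cos x)) =
      (\<Sum>n\<in>S \<union> T. c n * (\<kappa> * of_real (e n x)))" for x
  proof (rule complex_eqI)
    show "Re (of_real (e 1 x) * Complex (p (cos x)) (q (cos x))) =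
        Re (\<Sum>n\<in>S \<union> T. c n * (\<kappa> * of_real (e n x)))"
      using S(1) T(1) by (simp add: c S(3) del: One_nat_def) (intro sum.mono_neutral_cong_left; auto)
    show "Im (of_real (e 1 x) * Complex (p (cos x)) (q (cos x))) =
        Im (\<Sum>n\<in>S \<union> T. c n * (\<kappa> * of_real (e n x)))"
      using S(1) T(1) by (simp add: c T(3) del: One_nat_def) (intro sum.mono_neutral_cong_left; auto)
  qed
  with pq have "L2_norm half_circle (\<lambda>x. f x - (\<Sum>n\<in>S \<union> T. c n * (\<kappa> * of_real (e n x)))) < \<epsilon>"
    using \<open>\<epsilon> > 0\<close> by (simp add: L2_norm_def arc_measure_half real_less_lsqrt)
  with S T show ?thesis
    by (intro exI[of _ "S \<union> T"] exI[of _ c]) auto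
qed

text \<open>The recursion is the product-to-sum formula. At \<open>n = 1\<close> it reaches
  frequency \<open>-1/2\<close>, and parity leads back to \<open>e 1\<close>: with
  \<open>a = 1\<close> for the cosines and \<open>a = -1\<close> for the sines.\<close>

lemma in_span_mult_cos:
  assumes rec: "\<And>n x. e (Suc n) x * cos x = (e (Suc (Suc n)) x + e n x) / 2"
    and e0: "\<And>x. e 0 x = a * e 1 x" and "n \<ge> 1"
  shows "in_span e (\<lambda>x. e n x * cos x)"
proof -
  obtain k where n: "n = Suc k"
    using \<open>n \<ge> 1\<close> by (cases n) auto
  have "in_span e (e k)"
  proof (cases k)
    case 0
    have "e 0 = (\<lambda>x. a * e 1 x)"
      using e0 by auto
    with 0 in_span_scale[OF in_span_basis, of 1 e a] show ?thesis by simp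
  qed (auto intro: in_span_basis)
  then have "in_span e (\<lambda>x. 1 / 2 * (e (Suc n) x + e k x))"
    by (intro in_span_scale in_span_add in_span_basis[of "Suc n"]) auto
  then show ?thesis
    by (simp add: n rec)
qed

section \<open>Orthonormality of the half-angle systems\<close>

lemma integral_cos_int:
  "(LINT x|half_measure. complex_of_real (cos (of_int k * x))) = (if k = 0 then of_real pi else 0)"
proof -
  have "((\<lambda>x. if k = 0 then x else sin (of_int k * x) / of_int k) has_real_derivative
      cos (of_int k * x)) (at x)" for x
    by (cases "k = 0") (auto intro!: derivative_eq_intros)
  then have "((\<lambda>x. complex_of_real (if k = 0 then x else sin (of_int k * x) / of_int k))
      has_vector_derivative of_real (cos (of_int k * x))) (at x)" for x
    by (intro has_vector_derivative_of_real)
       (simp add: has_real_derivative_iff_has_vector_derivative)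
  moreover have "continuous_on {0..pi} (\<lambda>x. complex_of_real (cos (of_int k * x)))"
    by (intro continuous_intros)
  ultimately have "(LINT x|half_measure. complex_of_real (cos (of_int k * x))) =
      of_real (if k = 0 then pi else sin (of_int k * pi) / of_int k) -
      of_real (if k = 0 then 0 else sin (of_int k * 0) / of_int k)"
    by (rule integral_half_FTC)
  then show ?thesis
    using sin_npi_int[of k] by (auto simp: mult.commute)
qed

text \<open>Difference and sum of the two half-odd frequencies are the integers \<open>m - n\<close>
  and \<open>m + n - 1\<close>. The latter is positive because the indices start at 1, so only the
  diagonal contributes, with half the length of the interval.\<close>

lemma
  assumes "m \<ge> 1" "n \<ge> 1"
  shows integral_cos_cos: "(LINT x|half_measure. complex_of_real
      (cos ((real m - 1/2) * x) * cos ((real n - 1/2) * x))) = (if m = n then of_real (pi / 2) else 0)"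
    and integral_sin_sin: "(LINT x|half_measure. complex_of_real
      (sin ((real m - 1/2) * x) * sin ((real n - 1/2) * x))) = (if m = n then of_real (pi / 2) else 0)"
proof -
  let ?c = "\<lambda>k x. complex_of_real (cos (of_int k * x))"
  have arg: "(real m - 1/2) * x - (real n - 1/2) * x = of_int (int m - int n) * x"
    "(real m - 1/2) * x + (real n - 1/2) * x = of_int (int m + int n - 1) * x" for x
    by (simp_all add: algebra_simps)
  have int: "integrable half_measure (?c k)" for k
    by (intro continuous_half(3) continuous_intros)
  have cc: "complex_of_real (cos ((real m - 1/2) * x) * cos ((real n - 1/2) * x)) =
      1 / 2 * (?c (int m - int n) x + ?c (int m + int n - 1) x)" for x
    unfolding cos_times_cos arg by simp
  have ss: "complex_of_real (sin ((real m - 1/2) * x) * sin ((real n - 1/2) * x)) =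
      1 / 2 * (?c (int m - int n) x - ?c (int m + int n - 1) x)" for x
    unfolding sin_times_sin arg by simp
  have nz: "int m + int n - 1 \<noteq> 0" "int m - int n = 0 \<longleftrightarrow> m = n"
    using assms by auto
  have z: "(LINT x|half_measure. ?c (int m + int n - 1) x) = 0"
      "(LINT x|half_measure. ?c (int m - int n) x) = (if m = n then of_real pi else 0)"
    unfolding integral_cos_int using nz by auto
  show "(LINT x|half_measure. complex_of_real
      (cos ((real m - 1/2) * x) * cos ((real n - 1/2) * x))) = (if m = n then of_real (pi / 2) else 0)"
    unfolding cc integral_mult_right_zero Bochner_Integration.integral_add[OF int int] z by simp
  show "(LINT x|half_measure. complex_of_real
      (sin ((real m - 1/2) * x) * sin ((real n - 1/2) * x))) = (if m = n then of_real (pi / 2) else 0)"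
    unfolding ss integral_mult_right_zero Bochner_Integration.integral_diff[OF int int] z by simp
qed

lemma L2_inner_scaled:
  assumes "\<kappa> * cnj \<kappa> = of_real (2 / pi)"
    and "(LINT x|half_measure. complex_of_real (f x * g x)) = (if m = n then of_real (pi / 2) else 0)"
  shows "L2_inner half_circle (\<lambda>x. \<kappa> * of_real (f x)) (\<lambda>x. \<kappa> * of_real (g x)) = (if m = n then 1 else 0)"
proof -
  have "L2_inner half_circle (\<lambda>x. \<kappa> * of_real (f x)) (\<lambda>x. \<kappa> * of_real (g x)) =
      (LINT x|half_measure. \<kappa> * cnj \<kappa> * complex_of_real (f x * g x))"
    unfolding L2_inner_half by (simp add: mult_ac)
  also have "\<dots> = (if m = n then 1 else 0)"
    unfolding integral_mult_right_zero assms by simp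
  finally show ?thesis .
qed

lemma
  shows has_vector_derivative_scaled_cos: "((\<lambda>x. \<kappa> * complex_of_real (cos (a * x)))
      has_vector_derivative \<kappa> * of_real (- (a * sin (a * x)))) (at x)"
    and has_vector_derivative_scaled_sin: "((\<lambda>x. \<kappa> * complex_of_real (sin (a * x)))
      has_vector_derivative \<kappa> * of_real (a * cos (a * x))) (at x)"
  by (intro has_vector_derivative_mult_right has_vector_derivative_of_real;
      auto intro!: derivative_eq_intros simp: has_real_derivative_iff_has_vector_derivative[symmetric])+

section \<open>The Maxwell systems in degrees 0 and 1\<close>

lemma rot_R_subset_L2_closure: "rot_R S \<Gamma> q \<subseteq> L2_closure S (q + 1) (rot_R S \<Gamma> q)"
proof
  fix f assume f: "f \<in> rot_R S \<Gamma> q"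
  then have "f \<in> L2_forms S (q + 1)"
    by (auto simp: rot_R_def has_rot_def)
  moreover have "L2_norm S (\<lambda>x. f x - f x) = 0"
    by (simp add: L2_norm_def)
  ultimately show "f \<in> L2_closure S (q + 1) (rot_R S \<Gamma> q)"
    using f unfolding L2_closure_def by (auto intro!: bexI[of _ f])
qed

lemma cos_boundary: "cos ((real n - 1/2) * pi) = 0"
proof -
  have "(real n - 1/2) * pi = real n * pi - pi / 2"
    by (simp add: algebra_simps)
  then show ?thesis
    by (simp only: cos_diff sin_npi cos_pi_half)
qed

lemma maxwell_system_half_0:
  defines "C \<equiv> complex_of_real (sqrt (2 / pi))"
  shows "maxwell_system half_circle {(-1, 0)} {(1, 0)} 0 {1..}
    (\<lambda>n x. C * of_real (cos ((real n - 1/2) * x)))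
    (\<lambda>n x. C * (- \<i> * of_real (sin ((real n - 1/2) * x))))
    (\<lambda>n. real n - 1/2)"
proof -
  \<comment> \<open>Both trigonometric systems have squared norm \<open>pi / 2\<close>, whence
    \<open>C\<close>. The factor \<open>- \<i>\<close> has modulus one and is absorbed into the
    scalar, so sines and cosines fall under the same lemmas.\<close>
  let ?D = "C * (- \<i>)"
  let ?E = "\<lambda>n x. C * complex_of_real (cos ((real n - 1/2) * x))"
  let ?H = "\<lambda>n x. ?D * complex_of_real (sin ((real n - 1/2) * x))"
  let ?\<omega> = "\<lambda>n. real n - 1/2"
  have C: "C \<noteq> 0" "?D \<noteq> 0" "C * cnj C = of_real (2 / pi)" "?D * cnj ?D = of_real (2 / pi)"
  proof -
    show C2: "C * cnj C = of_real (2 / pi)"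
      by (simp add: C_def of_real_mult[symmetric] del: of_real_mult)
    moreover have "?D * cnj ?D = C * cnj C"
      by (simp add: complex_eq_iff)
    ultimately show "?D * cnj ?D = of_real (2 / pi)"
      by (simp only:)
  qed (simp_all add: C_def)
  have cont: "continuous_on S (\<lambda>x. \<kappa> * complex_of_real (a * cos (b * x)))"
      "continuous_on S (\<lambda>x. \<kappa> * complex_of_real (a * sin (b * x)))"
      "continuous_on S (\<lambda>x. \<kappa> * complex_of_real (- (a * sin (b * x))))" for S \<kappa> a b
    by (intro continuous_intros)+
  have Esq: "sq_int (?E n)" for n
    by (intro continuous_half(2) continuous_intros)
  have rot: "has_rot half_circle 0 (\<lambda>x. \<kappa> * of_real (cos (?\<omega> n * x)))
        (\<lambda>x. \<kappa> * of_real (- (?\<omega> n * sin (?\<omega> n * x))))"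
      "(\<lambda>x. \<kappa> * of_real (cos (?\<omega> n * x))) \<in> R_space half_circle {(1, 0)} 0" for \<kappa> n
  proof -
    show "has_rot half_circle 0 (\<lambda>x. \<kappa> * of_real (cos (?\<omega> n * x)))
        (\<lambda>x. \<kappa> * of_real (- (?\<omega> n * sin (?\<omega> n * x))))"
      by (rule has_rot_half(1)[OF has_vector_derivative_scaled_cos cont(3)])
    show "(\<lambda>x. \<kappa> * of_real (cos (?\<omega> n * x))) \<in> R_space half_circle {(1, 0)} 0"
      by (rule has_rot_half(2)[OF has_vector_derivative_scaled_cos cont(3)]) (simp add: cos_boundary)
  qed
  have div: "has_div half_circle 1 (?H n) (\<lambda>x. ?D * of_real (?\<omega> n * cos (?\<omega> n * x)))"
      "?H n \<in> D_space half_circle {(-1, 0)} 1" for n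
  proof -
    show "has_div half_circle 1 (?H n) (\<lambda>x. ?D * of_real (?\<omega> n * cos (?\<omega> n * x)))"
      by (rule has_div_half(1)[OF has_vector_derivative_scaled_sin cont(1)])
    show "?H n \<in> D_space half_circle {(-1, 0)} 1"
      by (rule has_div_half(2)[OF has_vector_derivative_scaled_sin cont(1)]) simp
  qed
  have arg: "?\<omega> (Suc k) * x - x = ?\<omega> k * x" "?\<omega> (Suc k) * x + x = ?\<omega> (Suc (Suc k)) * x" for k x
    by (simp_all add: algebra_simps)
  have E: "complete_orthonormal_system half_circle (D0_space half_circle {(-1, 0)} 0) {1..} ?E"
    unfolding complete_orthonormal_system_def D0_half_0
  proof (intro conjI ballI allI impI)
    fix m n :: nat assume "m \<in> {1..}" "n \<in> {1..}"
    then show "L2_inner half_circle (?E m) (?E n) = (if m = n then 1 else 0)"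
      by (intro L2_inner_scaled C integral_cos_cos) auto
  next
    fix f :: "real \<Rightarrow> complex" and \<epsilon> :: real assume "f \<in> {f. sq_int f}" "\<epsilon> > 0"
    moreover have "in_span (\<lambda>n x. cos (?\<omega> n * x)) (\<lambda>x. cos (?\<omega> n * x) * cos x)" if "n \<ge> 1" for n
      by (rule in_span_mult_cos[where a = 1 and e = "\<lambda>n x. cos (?\<omega> n * x)", OF _ _ that])
         (simp_all only: cos_times_cos arg, simp_all)
    ultimately show "\<exists>T c. finite T \<and> T \<subseteq> {1..} \<and> L2_norm half_circle (\<lambda>x. f x - (\<Sum>n\<in>T. c n * ?E n x)) < \<epsilon>"
      using cos_gt_zero by (intro span_dense C) (auto intro!: continuous_intros simp: less_imp_neq[symmetric])
  qed (use Esq in auto)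
  have H: "complete_orthonormal_system half_circle
      (L2_closure half_circle (0 + 1) (rot_R half_circle {(1, 0)} 0)) {1..} ?H"
    unfolding complete_orthonormal_system_def
  proof (intro conjI ballI allI impI)
    fix n :: nat assume "n \<in> {1..}"
    then have nz: "?\<omega> n \<noteq> 0"
      by auto
    \<comment> \<open>The preimage of \<open>?H n\<close> under the rotation is the cosine with this
      prefactor; dividing by the frequency is possible since it is nonzero.\<close>
    have "\<i> * C / of_real w * of_real (- (w * s)) = ?D * of_real s" if "w \<noteq> 0" for w s
      using that by simp
    from this[OF nz] have "(\<lambda>x. \<i> * C / of_real (?\<omega> n) * of_real (- (?\<omega> n * sin (?\<omega> n * x)))) = ?H n"
      by (rule ext)
    then have "?H n \<in> rot_R half_circle {(1, 0)} 0"
      using rot[of "\<i> * C / of_real (?\<omega> n)" n] unfolding rot_R_def by auto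
    then show "?H n \<in> L2_closure half_circle (0 + 1) (rot_R half_circle {(1, 0)} 0)"
      using rot_R_subset_L2_closure by blast
  next
    fix m n :: nat assume "m \<in> {1..}" "n \<in> {1..}"
    then show "L2_inner half_circle (?H m) (?H n) = (if m = n then 1 else 0)"
      by (intro L2_inner_scaled C integral_sin_sin) auto
  next
    fix f :: "real \<Rightarrow> complex" and \<epsilon> :: real
    assume "f \<in> L2_closure half_circle (0 + 1) (rot_R half_circle {(1, 0)} 0)" "\<epsilon> > 0"
    \<comment> \<open>The sines approximate every square-integrable function, in particular each
      element of the closed range of the rotation.\<close>
    then have "sq_int f" "\<epsilon> > 0"
      by (auto simp: L2_closure_def L2_forms_half)
    moreover have "in_span (\<lambda>n x. sin (?\<omega> n * x)) (\<lambda>x. sin (?\<omega> n * x) * cos x)" if "n \<ge> 1" for n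
      by (rule in_span_mult_cos[where a = "-1" and e = "\<lambda>n x. sin (?\<omega> n * x)", OF _ _ that])
         (simp_all only: sin_times_cos arg, simp_all)
    ultimately show "\<exists>T c. finite T \<and> T \<subseteq> {1..} \<and> L2_norm half_circle (\<lambda>x. f x - (\<Sum>n\<in>T. c n * ?H n x)) < \<epsilon>"
      using sin_gt_zero by (intro span_dense C) (auto intro!: continuous_intros simp: less_imp_neq[symmetric])
  qed
  have \<omega>: "filterlim ?\<omega> at_top sequentially"
    using filterlim_tendsto_add_at_top[OF tendsto_const[of "- (1/2)"] filterlim_real_sequentially] by simp
  have J: "{n \<in> {1..}. enat n > 0} = {1..}"
    by (auto simp: zero_enat_def)
  have Heq: "(\<lambda>n x. C * (- \<i> * of_real (sin (?\<omega> n * x)))) = ?H"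
    by (simp add: mult.assoc)
  have rot': "has_rot half_circle 0 (?E n) (\<lambda>x. - (\<i> * of_real (?\<omega> n) * ?H n x))"
      "?E n \<in> R_space half_circle {(1, 0)} 0" for n
    using rot[of C n] by (auto simp: algebra_simps)
  have div': "has_div half_circle 1 (?H n) (\<lambda>x. - (\<i> * of_real (?\<omega> n) * ?E n x))" for n
    using div(1)[of n] by (simp add: algebra_simps)
  show ?thesis
    unfolding maxwell_system_def harmonic_dim_half_0 Let_def J Heq
    using E H \<omega> rot' div(2) div' by auto
qed

lemma L2_norm_AE_0:
  assumes "AE x in half_measure. f x = 0" shows "L2_norm half_circle f = 0"
proof -
  have "(LINT x|half_measure. (cmod (f x))\<^sup>2) = 0"
    using assms by (intro integral_eq_zero_AE) auto
  then show ?thesis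
    by (simp add: L2_norm_def arc_measure_half)
qed

text \<open>A null form cannot have norm one, which rules out every index; conversely, the empty sum
  already approximates null forms.\<close>

lemma complete_orthonormal_system_AE_0:
  assumes "\<And>f. f \<in> V \<Longrightarrow> AE x in half_measure. f x = 0"
  shows "complete_orthonormal_system half_circle V J e \<longleftrightarrow> J = {}"
proof
  assume ons: "complete_orthonormal_system half_circle V J e"
  show "J = {}"
  proof (rule ccontr)
    assume "J \<noteq> {}"
    then obtain n where n: "e n \<in> V" "L2_inner half_circle (e n) (e n) = 1"
      using ons unfolding complete_orthonormal_system_def by fastforce
    have "L2_inner half_circle (e n) (e n) = 0"
      unfolding L2_inner_half using assms[OF n(1)] by (intro integral_eq_zero_AE) auto
    with n(2) show False by simp
  qed
qed (use assms L2_norm_AE_0 in \<open>simp add: complete_orthonormal_system_def\<close>)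

text \<open>The equivalence also asserts that the empty system is admissible. The range of the
  rotation consists of forms of degree 2, which vanish on the half circle, so both completeness
  conditions concern null forms only.\<close>

lemma maxwell_system_half_1:
  "maxwell_system half_circle {(-1, 0)} \<Gamma>2 1 I E H \<omega> \<longleftrightarrow> I = {}"
proof -
  have "AE x in half_measure. f x = 0" if "f \<in> L2_closure half_circle 2 V" for f V
  proof (intro AE_I2)
    fix x assume "x \<in> space half_measure"
    then have "circle_point x \<in> half_circle"
      unfolding circle_point_half by (simp add: sin_gt_zero)
    moreover have "circle_point \<phi> \<in> half_circle \<longrightarrow> f \<phi> = 0" for \<phi>
      using that by (simp add: L2_closure_def L2_forms_def)
    ultimately show "f x = 0" by blast
  qed
  from complete_orthonormal_system_AE_0[OF this] complete_orthonormal_system_AE_0[OF D0_half_AE_0]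
  show ?thesis
    unfolding maxwell_system_def Let_def by auto
qed

theorem mainTheorem12:
  fixes K \<gamma>1 \<gamma>2 :: "(real \<times> real) set"
  assumes K: "K = {(cos \<phi>, sin \<phi>) |\<phi>. 0 < \<phi> \<and> \<phi> < pi}"
    and \<gamma>1: "\<gamma>1 = {(-1, 0)}"
    and \<gamma>2: "\<gamma>2 = {(1, 0)}"
  shows "harmonic_dim K \<gamma>1 \<gamma>2 0 = 0 \<and>
    (\<exists>c :: nat \<Rightarrow> complex. (\<forall>n\<ge>1. c n \<noteq> 0) \<and>
      maxwell_system K \<gamma>1 \<gamma>2 0 {1..}
        (\<lambda>n \<phi>. c n * of_real (cos ((real n - 1/2) * \<phi>)))
        (\<lambda>n \<phi>. c n * (- \<i> * of_real (sin ((real n - 1/2) * \<phi>))))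
        (\<lambda>n. real n - 1/2)) \<and>
    (\<forall>I E H \<omega>. maxwell_system K \<gamma>1 \<gamma>2 1 I E H \<omega> \<longleftrightarrow> I = {})"
  unfolding K \<gamma>1 \<gamma>2
  using harmonic_dim_half_0 maxwell_system_half_0 maxwell_system_half_1
  by (auto intro!: exI[of _ "\<lambda>_. complex_of_real (sqrt (2 / pi))"])

end
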